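(* Let $p \colon E \to B$ be a locally trivial fibration, where $E$ and $B$ are metrizable separable ANRs. Then $\mathrm{TC}[p \colon E \to B] = \mathrm{TC}_g[p \colon E \to B]$. If $\{U_i\}_{i=0}^{k}$ is a (not necessarily open) cover of $E \times_B E$ with sections $s_i \colon U_i \to E^{I}_B$ of $\Pi$ such that $\Delta E \subset U_0$, then $$\mathrm{TC}^{M}[p \colon E \to B] \leq k.$$ Moreover, if $\mathrm{TC}[p \colon E \to B] = k$, then $$\mathrm{TC}^M[p \colon E \to B] = \mathrm{TC}[p \colon E \to B] = \mathrm{TC}_g[p \colon E \to B] = k.$$
   Context: Fibration means Hurewicz fibration, $I=[0,1]$. For a fibration $p \colon E \to B$: $E \times_B E = \{(e_1,e_2)\in E\times E \mid p(e_1)=p(e_2)\}$ with diagonal $\Delta E = \{(e,e)\mid e\in E\}$; $E^I_B = \{\gamma \in E^I \mid p\circ\gamma \text{ is constant}\}$ (subspace of $E^I$ with compact-open topology); $\Pi \colon E^I_B \to E \times_B E$, $\Pi(\gamma) = (\gamma(0),\gamma(1))$, which is a fibration; $\mathrm{c}_e$ is the constant path at $e$. ANR means absolute neighborhood retract for metrizable spaces. Sections are continuous. $\mathrm{TC}[p \colon E\to B]$ (parametrized topological complexity) is the sectional category of $\Pi$: the least nonnegative integer $n$ such that $E \times_B E$ has an open cover $\{V_0,\dots,V_n\}$ with a section of $\Pi$ over each $V_i$ ($\infty$ if none exists). $\mathrm{TC}_g[p \colon E\to B]$ (generalized parametrized topological complexity) is defined in the same way except that the covering sets are not required to be open. $\mathrm{TC}^{M}[p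 \colon E\to B]$ (monoidal parametrized topological complexity) is the least nonnegative integer $n$ such that $E \times_B E$ may be covered by open subsets $V_0,\dots,V_n$, each containing $\Delta E$ and admitting a section $\sigma_i \colon V_i \to E^I_B$ of $\Pi$ with $\sigma_i(e,e) = \mathrm{c}_e$ for all $e \in E$ ($\infty$ if none exists). *)

theory Defs
  imports "HOL-Analysis.Analysis" "HOL-Library.Extended_Nat"
begin

section \<open>Path spaces\<close>

abbreviation unit_interval :: "real topology" where
  "unit_interval \<equiv> top_of_set {0..1}"

text \<open>
  The space of paths in a topological space, with the compact-open topology. Paths are extensional
  functions on the unit interval, so that equality of paths is equality on the unit interval.
  The choice of the empty compact set shows that the underlying set consists of all paths.
\<close>

definition paths :: "'a topology \<Rightarrow> (real \<Rightarrow> 'a) set" where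
  "paths X = {\<gamma> \<in> extensional {0..1}. pathin X \<gamma>}"

definition path_space :: "'a topology \<Rightarrow> (real \<Rightarrow> 'a) topology" where
  "path_space X = topology_generated_by
     {{\<gamma> \<in> paths X. \<gamma> ` K \<subseteq> U} | K U. compact K \<and> K \<subseteq> {0..1} \<and> openin X U}"

definition const_path :: "'a \<Rightarrow> real \<Rightarrow> 'a" where
  "const_path e = restrict (\<lambda>t. e) {0..1}"


section \<open>Hurewicz fibrations and local triviality\<close>

definition has_HLP :: "'c topology \<Rightarrow> 'a topology \<Rightarrow> 'b topology \<Rightarrow> ('a \<Rightarrow> 'b) \<Rightarrow> bool" where
  "has_HLP Y E B p \<longleftrightarrow>
    (\<forall>f H. continuous_map Y E f \<and>
           continuous_map (prod_topology Y unit_interval) B H \<and>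
           (\<forall>y\<in>topspace Y. H (y, 0) = p (f y)) \<longrightarrow>
       (\<exists>G. continuous_map (prod_topology Y unit_interval) E G \<and>
            (\<forall>y\<in>topspace Y. G (y, 0) = f y) \<and>
            (\<forall>y\<in>topspace Y. \<forall>t\<in>{0..1}. p (G (y, t)) = H (y, t))))"

text \<open>
  A Hurewicz fibration has the homotopy lifting property for all topological spaces \<open>Y\<close>. Types
  cannot be quantified inside a definition, so the points of \<open>Y\<close> are drawn from the type of the
  mapping path space of \<open>p\<close>, which is the universal test space. Lemma \<open>hurewicz_fibration_HLP\<close>
  shows that the homotopy lifting property for spaces over every other type follows.
\<close>

definition hurewicz_fibration :: "'a topology \<Rightarrow> 'b topology \<Rightarrow> ('a \<Rightarrow> 'b) \<Rightarrow> bool" where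
  "hurewicz_fibration E B p \<longleftrightarrow>
     continuous_map E B p \<and> (\<forall>Y :: ('a \<times> (real \<Rightarrow> 'b)) topology. has_HLP Y E B p)"

text \<open>
  The local fibre \<open>F\<close> may depend on the trivialising set \<open>U\<close>. It is homeomorphic to
  the fibre of \<open>p\<close> over \<open>b\<close>, so taking it over the type of points of \<open>E\<close> is no restriction.
\<close>

definition locally_trivial :: "'a topology \<Rightarrow> 'b topology \<Rightarrow> ('a \<Rightarrow> 'b) \<Rightarrow> bool" where
  "locally_trivial E B p \<longleftrightarrow>
    (\<forall>b\<in>topspace B. \<exists>U (F :: 'a topology) h.
       openin B U \<and> b \<in> U \<and>
       homeomorphic_map (subtopology E {e. p e \<in> U}) (prod_topology (subtopology B U) F) h \<and>
       (\<forall>e\<in>topspace E. p e \<in> U \<longrightarrow> fst (h e) = p e))"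

definition locally_trivial_fibration :: "'a topology \<Rightarrow> 'b topology \<Rightarrow> ('a \<Rightarrow> 'b) \<Rightarrow> bool" where
  "locally_trivial_fibration E B p \<longleftrightarrow> hurewicz_fibration E B p \<and> locally_trivial E B p"

lemma topspace_path_space [simp]: "topspace (path_space X) = paths X"
proof -
  have "paths X \<in> {{\<gamma> \<in> paths X. \<gamma> ` K \<subseteq> U} | K U. compact K \<and> K \<subseteq> {0..1} \<and> openin X U}"
    by (rule CollectI, rule exI[of _ "{}"], rule exI[of _ "{}"]) auto
  then show ?thesis
    unfolding path_space_def topology_generated_by_topspace by blast
qed

lemma openin_path_space_subbasic:
  assumes "compact K" "K \<subseteq> {0..1}" "openin X U"
  shows "openin (path_space X) {\<gamma> \<in> paths X. \<gamma> ` K \<subseteq> U}"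
  unfolding path_space_def using assms by (intro topology_generated_by_Basis) blast

lemma continuous_map_path_eval:
  "continuous_map (prod_topology (path_space X) unit_interval) X (\<lambda>(\<gamma>, t). \<gamma> t)"
  unfolding continuous_map_def
proof (intro conjI funcsetI allI impI)
  fix z assume "z \<in> topspace (prod_topology (path_space X) unit_interval)"
  then show "(case z of (\<gamma>, t) \<Rightarrow> \<gamma> t) \<in> topspace X"
    by (auto simp: paths_def pathin_def continuous_map_def)
next
  fix U assume U: "openin X U"
  let ?P = "prod_topology (path_space X) unit_interval"
  let ?S = "{z \<in> topspace ?P. (case z of (\<gamma>, t) \<Rightarrow> \<gamma> t) \<in> U}"
  show "openin ?P ?S"
  proof (subst openin_subopen, intro ballI)
    fix z assume "z \<in> ?S"
    then obtain \<gamma> t where z: "z = (\<gamma>, t)" "\<gamma> \<in> paths X" "t \<in> {0..1}" "\<gamma> t \<in> U"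
      by auto
    have "openin unit_interval {s \<in> {0..1}. \<gamma> s \<in> U}"
      using z U by (auto simp: paths_def pathin_def continuous_map_def)
    then obtain e where e: "e > 0" "\<And>s. s \<in> {0..1} \<Longrightarrow> dist s t < e \<Longrightarrow> \<gamma> s \<in> U"
      using z unfolding openin_euclidean_subtopology_iff by blast
    define K where "K = cball t (e/2) \<inter> {0..1::real}"
    define N where "N = ball t (e/2) \<inter> {0..1::real}"
    have K: "compact K" "K \<subseteq> {0..1}"
      by (auto simp: K_def compact_Int)
    have N: "openin unit_interval N" "t \<in> N" "N \<subseteq> K"
      using e z by (auto simp: N_def K_def openin_open)
    have gK: "\<gamma> ` K \<subseteq> U"
      using e by (auto simp: K_def dist_commute)
    have "openin ?P ({\<delta> \<in> paths X. \<delta> ` K \<subseteq> U} \<times> N)"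
      using openin_path_space_subbasic[OF K U] N openin_prod_Times_iff by blast
    moreover have "z \<in> {\<delta> \<in> paths X. \<delta> ` K \<subseteq> U} \<times> N"
      using z N gK by auto
    moreover have "{\<delta> \<in> paths X. \<delta> ` K \<subseteq> U} \<times> N \<subseteq> ?S"
      using N K by auto
    ultimately show "\<exists>T. openin ?P T \<and> z \<in> T \<and> T \<subseteq> ?S"
      by blast
  qed
qed

lemma continuous_map_path_curry:
  assumes H: "continuous_map (prod_topology Y unit_interval) X H"
  shows "continuous_map Y (path_space X) (\<lambda>y. restrict (\<lambda>t. H (y, t)) {0..1})" (is "continuous_map _ _ ?c")
proof -
  have c_paths: "?c y \<in> paths X" if "y \<in> topspace Y" for y
  proof -
    have "continuous_map unit_interval (prod_topology Y unit_interval) (\<lambda>t. (y, t))"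
      using that by (intro continuous_map_pairedI) auto
    from continuous_map_compose[OF this H]
    have "continuous_map unit_interval X (?c y)"
      by (rule continuous_map_eq) auto
    then show ?thesis
      by (simp add: paths_def pathin_def)
  qed
  have "openin Y (?c -` T \<inter> topspace Y)"
    if T: "T \<in> {{\<gamma> \<in> paths X. \<gamma> ` K \<subseteq> U} | K U. compact K \<and> K \<subseteq> {0..1} \<and> openin X U}" for T
  proof -
    obtain K U where KU: "T = {\<gamma> \<in> paths X. \<gamma> ` K \<subseteq> U}" "compact K" "K \<subseteq> {0..1}" "openin X U"
      using T by blast
    let ?P = "prod_topology Y (top_of_set K)"
    have "(topspace Y \<times> {0..1}) \<inter> (UNIV \<times> K) = topspace Y \<times> K"
      using KU(3) by auto
    then have HK: "continuous_map ?P X H"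
      using continuous_map_from_subtopology[OF H, of "UNIV \<times> K"]
      by (simp add: prod_topology_subtopology(2) subtopology_subtopology)
    define C where "C = {z \<in> topspace ?P. H z \<in> topspace X - U}"
    have "closedin ?P C"
      unfolding C_def using KU(4) by (intro closedin_continuous_map_preimage[OF HK]) blast
    moreover have "closed_map ?P Y fst"
      using KU by (intro closed_map_fst) (simp add: compact_space_subtopology)
    ultimately have "closedin Y (fst ` C)"
      unfolding closed_map_def by blast
    then have "openin Y (topspace Y - fst ` C)"
      by blast
    moreover have "topspace Y - fst ` C = ?c -` T \<inter> topspace Y"
    proof -
      have HX: "H (y, t) \<in> topspace X" if "y \<in> topspace Y" "t \<in> K" for y t
        using HK that by (auto simp: continuous_map_def Pi_iff)
      have fst_C: "y \<in> fst ` C \<longleftrightarrow> (\<exists>t\<in>K. H (y, t) \<notin> U)" if "y \<in> topspace Y" for y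
      proof
        assume "y \<in> fst ` C"
        then show "\<exists>t\<in>K. H (y, t) \<notin> U"
          by (auto simp: C_def)
      next
        assume "\<exists>t\<in>K. H (y, t) \<notin> U"
        then obtain t where t: "t \<in> K" "H (y, t) \<notin> U" ..
        then have "(y, t) \<in> C"
          using that t HX[OF that t(1)] by (simp add: C_def)
        then show "y \<in> fst ` C"
          by (metis fst_conv imageI)
      qed
      have c_T: "?c y \<in> T \<longleftrightarrow> (\<forall>t\<in>K. H (y, t) \<in> U)" if "y \<in> topspace Y" for y
      proof -
        have "?c y ` K = (\<lambda>t. H (y, t)) ` K"
          using KU(3) by (intro image_cong) auto
        then have "?c y ` K \<subseteq> U \<longleftrightarrow> (\<forall>t\<in>K. H (y, t) \<in> U)"
          by (simp only: image_subset_iff)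
        then show ?thesis
          using c_paths[OF that] unfolding KU(1) by blast
      qed
      show ?thesis
      proof (rule set_eqI)
        fix y
        show "y \<in> topspace Y - fst ` C \<longleftrightarrow> y \<in> ?c -` T \<inter> topspace Y"
        proof (cases "y \<in> topspace Y")
          case True
          then show ?thesis
            unfolding Diff_iff Int_iff vimage_eq fst_C[OF True] c_T[OF True] by blast
        next
          case False
          then show ?thesis
            by (simp only: Diff_iff Int_iff simp_thms)
        qed
      qed
    qed
    ultimately show ?thesis
      by (simp only:)
  qed
  moreover have "?c ` topspace Y \<subseteq> topspace (path_space X)"
    using c_paths by auto
  ultimately show ?thesis
    unfolding path_space_def
    by (intro continuous_on_generated_topo) (auto simp: topology_generated_by_topspace)
qed

lemma hurewicz_fibration_HLP:
  fixes E :: "'a topology" and B :: "'b topology" and Y :: "'c topology"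
  assumes "hurewicz_fibration E B p"
  shows "has_HLP Y E B p"
  unfolding has_HLP_def
proof (intro allI impI, elim conjE)
  fix f H
  assume f: "continuous_map Y E f"
    and H: "continuous_map (prod_topology Y unit_interval) B H"
    and fH: "\<forall>y\<in>topspace Y. H (y, 0) = p (f y)"
  define M where "M = subtopology (prod_topology E (path_space B)) {(e, w). w 0 = p e}"
  have fst_M: "continuous_map M E fst" and snd_M: "continuous_map M (path_space B) snd"
    unfolding M_def by (auto intro: continuous_map_from_subtopology continuous_map_fst continuous_map_snd)
  have "continuous_map (prod_topology M unit_interval) (prod_topology (path_space B) unit_interval)
          (\<lambda>(m, t). (snd m, t))"
    using continuous_map_prod_top[of M unit_interval "path_space B" unit_interval snd "\<lambda>t. t"] snd_M by auto
  from continuous_map_compose[OF this continuous_map_path_eval]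
  have ev: "continuous_map (prod_topology M unit_interval) B (\<lambda>(m, t). snd m t)"
    by (simp add: o_def case_prod_unfold)
  have "has_HLP M E B p"
    using assms by (simp add: hurewicz_fibration_def)
  moreover have "\<forall>m\<in>topspace M. (\<lambda>(m, t). snd m t) (m, 0) = p (fst m)"
    by (auto simp: M_def)
  ultimately obtain L where L: "continuous_map (prod_topology M unit_interval) E L"
      "\<forall>m\<in>topspace M. L (m, 0) = fst m"
      "\<forall>m\<in>topspace M. \<forall>t\<in>{0..1}. p (L (m, t)) = (\<lambda>(m, t). snd m t) (m, t)"
    unfolding has_HLP_def using fst_M ev by blast
  define g where "g = (\<lambda>y. (f y, restrict (\<lambda>t. H (y, t)) {0..1}))"
  have g: "continuous_map Y M g"
    unfolding M_def g_def
    using f fH continuous_map_path_curry[OF H]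
    by (intro continuous_map_into_subtopology continuous_map_pairedI) auto
  have gM: "g y \<in> topspace M" if "y \<in> topspace Y" for y
    using g that by (auto simp: continuous_map_def)
  have "continuous_map (prod_topology Y unit_interval) (prod_topology M unit_interval) (\<lambda>(y, t). (g y, t))"
    using continuous_map_prod_top[of Y unit_interval M unit_interval g "\<lambda>t. t"] g by auto
  from continuous_map_compose[OF this L(1)]
  have "continuous_map (prod_topology Y unit_interval) E (\<lambda>(y, t). L (g y, t))"
    by (simp add: o_def case_prod_unfold)
  moreover have "\<forall>y\<in>topspace Y. (\<lambda>(y, t). L (g y, t)) (y, 0) = f y"
    using L(2) gM by (simp add: g_def)
  moreover have "\<forall>y\<in>topspace Y. \<forall>t\<in>{0..1}. p ((\<lambda>(y, t). L (g y, t)) (y, t)) = H (y, t)"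
    using L(3) gM by (simp add: g_def)
  ultimately show "\<exists>G. continuous_map (prod_topology Y unit_interval) E G \<and>
            (\<forall>y\<in>topspace Y. G (y, 0) = f y) \<and>
            (\<forall>y\<in>topspace Y. \<forall>t\<in>{0..1}. p (G (y, t)) = H (y, t))"
    by blast
qed


section \<open>Absolute neighbourhood retracts\<close>

text \<open>
  A metrizable space \<open>X\<close> is an ANR if, for every closed embedding of \<open>X\<close> into a metrizable space
  \<open>Z\<close>, the image of \<open>X\<close> is a retract of an open neighbourhood of it in \<open>Z\<close>. (The library constant
  \<open>ANR\<close> concerns subsets of Euclidean spaces only.) The points of \<open>Z\<close> are drawn from the type
  \<open>'a \<Rightarrow> real\<close>, which loses no generality: by Kuratowski and Wojdyslawski, \<open>X\<close> is homeomorphic to a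
  closed subset of a convex set \<open>C\<close> of bounded real functions on \<open>X\<close> with the supremum norm
  (extended by zero to functions on the type \<open>'a\<close>). By Dugundji's extension theorem, \<open>C\<close> is an
  absolute extensor for metrizable spaces, so if \<open>X\<close> is a neighbourhood retract of \<open>C\<close>, then it is
  a neighbourhood retract of every metrizable space that contains it as a closed subspace.
\<close>

definition metrizable_ANR :: "'a topology \<Rightarrow> bool" where
  "metrizable_ANR X \<longleftrightarrow> metrizable_space X \<and>
    (\<forall>(Z :: ('a \<Rightarrow> real) topology) i.
       metrizable_space Z \<and> embedding_map X Z i \<and> closedin Z (i ` topspace X) \<longrightarrow>
       (\<exists>W. openin Z W \<and> i ` topspace X \<subseteq> W \<and>
            i ` topspace X retract_of_space subtopology Z W))"


section \<open>Parametrized topological complexity\<close>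

definition fibre_square :: "'a topology \<Rightarrow> ('a \<Rightarrow> 'b) \<Rightarrow> ('a \<times> 'a) topology" where
  "fibre_square E p = subtopology (prod_topology E E) {(e1, e2). p e1 = p e2}"

definition diagonal :: "'a topology \<Rightarrow> ('a \<times> 'a) set" where
  "diagonal E = {(e, e) | e. e \<in> topspace E}"

definition fibrewise_path_space :: "'a topology \<Rightarrow> ('a \<Rightarrow> 'b) \<Rightarrow> (real \<Rightarrow> 'a) topology" where
  "fibrewise_path_space E p = subtopology (path_space E) {\<gamma>. \<exists>b. \<forall>t\<in>{0..1}. p (\<gamma> t) = b}"

definition endpoints :: "(real \<Rightarrow> 'a) \<Rightarrow> 'a \<times> 'a" where
  "endpoints \<gamma> = (\<gamma> 0, \<gamma> 1)"

definition section_over ::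
    "'a topology \<Rightarrow> ('a \<Rightarrow> 'b) \<Rightarrow> ('a \<times> 'a) set \<Rightarrow> ('a \<times> 'a \<Rightarrow> real \<Rightarrow> 'a) \<Rightarrow> bool" where
  "section_over E p V s \<longleftrightarrow>
     continuous_map (subtopology (fibre_square E p) V) (fibrewise_path_space E p) s \<and>
     (\<forall>x\<in>V. endpoints (s x) = x)"

definition covers_fibre_square ::
    "'a topology \<Rightarrow> ('a \<Rightarrow> 'b) \<Rightarrow> nat \<Rightarrow> (nat \<Rightarrow> ('a \<times> 'a) set) \<Rightarrow> bool" where
  "covers_fibre_square E p n V \<longleftrightarrow> (\<Union>i\<le>n. V i) = topspace (fibre_square E p)"

definition least_enat :: "(nat \<Rightarrow> bool) \<Rightarrow> enat" where
  "least_enat P = (if \<exists>n. P n then enat (LEAST n. P n) else \<infinity>)"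

definition TC :: "'a topology \<Rightarrow> ('a \<Rightarrow> 'b) \<Rightarrow> enat" where
  "TC E p = least_enat (\<lambda>n. \<exists>V. covers_fibre_square E p n V \<and>
     (\<forall>i\<le>n. openin (fibre_square E p) (V i) \<and> (\<exists>s. section_over E p (V i) s)))"

definition TC_gen :: "'a topology \<Rightarrow> ('a \<Rightarrow> 'b) \<Rightarrow> enat" where
  "TC_gen E p = least_enat (\<lambda>n. \<exists>V. covers_fibre_square E p n V \<and>
     (\<forall>i\<le>n. \<exists>s. section_over E p (V i) s))"

definition TC_mon :: "'a topology \<Rightarrow> ('a \<Rightarrow> 'b) \<Rightarrow> enat" where
  "TC_mon E p = least_enat (\<lambda>n. \<exists>V. covers_fibre_square E p n V \<and>
     (\<forall>i\<le>n. openin (fibre_square E p) (V i) \<and> diagonal E \<subseteq> V i \<and>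
        (\<exists>s. section_over E p (V i) s \<and> (\<forall>e\<in>topspace E. s (e, e) = const_path e))))"

end

theory Submission
  imports Defs
begin

text \<open>
  Sections of \<open>\<Pi>\<close> are homotopies through the fibres between the two projections of \<open>E \<times>\<^sub>B E\<close>. As \<open>B\<close> is
  an ANR, points that are close in \<open>B\<close> are joined by a canonical path, and lifting it moves points of
  \<open>E\<close> into prescribed nearby fibres. Applied to the canonical short paths of the ANR \<open>E\<close>, this gives
  a section near the diagonal that is constant on it. A section over an arbitrary
  subset is, as a map into \<open>E\<close>, approximated by a map on an open neighbourhood, obtained by
  averaging in a sequence space and retracting; moving the values back into the right fibres and
  correcting the endpoints with the local section near the diagonal gives a section over an open
  set. For the monoidal version, the open set containing the diagonal has its section shrunk to a
  constant along the diagonal, and the other sets are cut off near the diagonal and replaced there by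
  the local section.
\<close>

section \<open>General topology\<close>

text \<open>A section over \<open>U\<close> need not extend continuously to a neighbourhood, because
  \<open>U\<close> need not be closed. Only approximation is available, and it destroys both the
  fibre condition and the endpoints. Whatever has to survive is therefore encoded in one open
  relation \<open>R\<close> between a point and its value, chosen so that both repairs apply:
  transport along \<open>p\<close>, then the local section near the diagonal. Transport fixes points
  that already lie in the right fibre, so the given section itself satisfies \<open>R\<close>. The
  approximation acts on the adjoint map \<open>U \<times> I \<rightarrow> E\<close>, whose target is
  the ANR \<open>E\<close> rather than a path space. Compactness of the interval then returns an
  open subset of the base. Separability provides countably many distance coordinates. In sequence
  space short paths and weighted averages can be written down explicitly, and the same retraction
  onto the ANR turns both into maps with values in it.\<close>

lemma second_countable_prod_topology:
  assumes "second_countable X" "second_countable Y"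
  shows "second_countable (prod_topology X Y)"
proof -
  obtain A B where A: "countable A" "\<And>V. V \<in> A \<Longrightarrow> openin X V"
      "\<And>U x. openin X U \<Longrightarrow> x \<in> U \<Longrightarrow> \<exists>V\<in>A. x \<in> V \<and> V \<subseteq> U"
    and B: "countable B" "\<And>V. V \<in> B \<Longrightarrow> openin Y V"
      "\<And>U x. openin Y U \<Longrightarrow> x \<in> U \<Longrightarrow> \<exists>V\<in>B. x \<in> V \<and> V \<subseteq> U"
    using assms unfolding second_countable_def by metis
  show ?thesis
    unfolding second_countable_def
  proof (intro exI[of _ "(\<lambda>(a, b). a \<times> b) ` (A \<times> B)"] conjI ballI allI impI)
    show "countable ((\<lambda>(a, b). a \<times> b) ` (A \<times> B))"
      using A(1) B(1) by blast
    show "openin (prod_topology X Y) V" if "V \<in> (\<lambda>(a, b). a \<times> b) ` (A \<times> B)" for V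
      using that A(2) B(2) by (auto simp: openin_prod_Times_iff)
    fix U z assume "openin (prod_topology X Y) U \<and> z \<in> U"
    then obtain S T where ST: "openin X S" "openin Y T" "z \<in> S \<times> T" "S \<times> T \<subseteq> U"
      by (cases z) (metis mem_Sigma_iff openin_prod_topology_alt)
    then obtain V W where "V \<in> A" "fst z \<in> V" "V \<subseteq> S" "W \<in> B" "snd z \<in> W" "W \<subseteq> T"
      by (metis A(3) B(3) mem_Times_iff)
    then show "\<exists>V\<in>(\<lambda>(a, b). a \<times> b) ` (A \<times> B). z \<in> V \<and> V \<subseteq> U"
      using ST(4) by (intro bexI[of _ "V \<times> W"]) (auto simp: mem_Times_iff)
  qed
qed

lemma second_countable_euclidean: "second_countable (euclidean :: 'a::second_countable_topology topology)"
proof -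
  obtain \<B> :: "'a set set" where "countable \<B>" "\<And>C. C \<in> \<B> \<Longrightarrow> open C"
      "\<And>S. open S \<Longrightarrow> \<exists>U. U \<subseteq> \<B> \<and> S = \<Union>U"
    using univ_second_countable by blast
  note B = this
  have "\<exists>V\<in>\<B>. x \<in> V \<and> V \<subseteq> U" if U: "open U" "x \<in> U" for U x
  proof -
    obtain \<U> where "\<U> \<subseteq> \<B>" "U = \<Union>\<U>"
      using B(3)[OF U(1)] by blast
    with U(2) show ?thesis by blast
  qed
  with B(1,2) show ?thesis
    unfolding second_countable_def by (metis open_openin)
qed

text \<open>The bound 1 lets a distance serve as a time in \<open>{0..1}\<close> and keeps weighted
  sums of distance coordinates summable.\<close>

lemma metrizable_space_bounded_metric:
  assumes "metrizable_space X"
  obtains m where "X = mtopology_of m" "\<And>x y. mdist m x y \<le> 1"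
proof -
  obtain m where "X = mtopology_of m"
    using assms unfolding metrizable_space_def by (metis Metric_space.mtopology_of)
  then show thesis
    by (intro that[of "capped_metric 1 m"]) (auto simp: mtopology_capped_metric mdist_capped)
qed

lemma openin_mtopology_of:
  "openin (mtopology_of m) U \<longleftrightarrow>
     U \<subseteq> mspace m \<and> (\<forall>x\<in>U. \<exists>r>0. \<forall>y\<in>mspace m. mdist m x y < r \<longrightarrow> y \<in> U)"
proof -
  interpret Metric_space "mspace m" "mdist m" by simp
  have "mball x r \<subseteq> U \<longleftrightarrow> (\<forall>y\<in>mspace m. mdist m x y < r \<longrightarrow> y \<in> U)" if "x \<in> mspace m" for x r
    using that by (auto simp: subset_iff)
  then show ?thesis
    unfolding mtopology_of_def openin_mtopology by (metis subsetD)
qed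

lemma separable_imp_second_countable:
  assumes "metrizable_space X" "separable_space X"
  shows "second_countable X"
proof -
  obtain m where X: "X = mtopology_of m"
    using metrizable_space_bounded_metric[OF assms(1)] .
  interpret Metric_space "mspace m" "mdist m" by simp
  have X': "X = mtopology" by (simp add: X mtopology_of_def)
  obtain C where C: "countable C" "C \<subseteq> mspace m" "X closure_of C = mspace m"
    using assms(2) X unfolding separable_space_def by auto
  show ?thesis
    unfolding second_countable_def
  proof (intro exI[of _ "(\<lambda>(c, n). mball c (inverse (Suc n))) ` (C \<times> UNIV)"] conjI ballI allI impI)
    show "countable ((\<lambda>(c, n). mball c (inverse (Suc n))) ` (C \<times> UNIV))"
      using C(1) by blast
    show "openin X V" if "V \<in> (\<lambda>(c, n). mball c (inverse (Suc n))) ` (C \<times> UNIV)" for V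
      using that X' by auto
    fix U x assume U: "openin X U \<and> x \<in> U"
    then obtain r where r: "r > 0" "mball x r \<subseteq> U" "x \<in> mspace m"
      unfolding X' openin_mtopology by blast
    then obtain n where n: "inverse (Suc n) < r/2"
      using reals_Archimedean[of "r/2"] by auto
    then have "x \<in> mtopology closure_of C"
      using C(3) r X' by auto
    then obtain c where c: "c \<in> C" "c \<in> mball x (inverse (Suc n))"
      unfolding metric_closure_of by (auto simp: in_mball) (metis inverse_positive_iff_positive of_nat_0_less_iff zero_less_Suc of_nat_Suc)
    have "mball c (inverse (Suc n)) \<subseteq> mball x r"
      using c n C(2) r by (intro mball_subset) (auto simp: commute)
    moreover have "x \<in> mball c (inverse (Suc n))"
      using c by (auto simp: commute)
    ultimately show "\<exists>V\<in>(\<lambda>(c, n). mball c (inverse (Suc n))) ` (C \<times> UNIV). x \<in> V \<and> V \<subseteq> U"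
      using c(1) r(2) by (intro bexI[of _ "mball c (inverse (Suc n))"]) auto
  qed
qed

lemma continuous_map_suminf:
  fixes f :: "nat \<Rightarrow> 'a \<Rightarrow> real"
  assumes "\<And>n. continuous_map X euclideanreal (f n)"
    and "\<And>n x. x \<in> topspace X \<Longrightarrow> \<bar>f n x\<bar> \<le> M n" and "summable M"
  shows "continuous_map X euclideanreal (\<lambda>x. \<Sum>n. f n x)"
proof -
  have u: "uniform_limit (topspace X) (\<lambda>n x. \<Sum>i<n. f i x) (\<lambda>x. \<Sum>i. f i x) sequentially"
    using assms by (intro Weierstrass_m_test) auto
  have "continuous_map X (Met_TC.mtopology) (\<lambda>x. \<Sum>n. f n x)"
  proof (rule Met_TC.continuous_map_uniform_limit[where F = sequentially])
    show "\<forall>\<^sub>F n in sequentially. continuous_map X Met_TC.mtopology (\<lambda>x. \<Sum>i<n. f i x)"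
      using assms(1) by (auto intro!: always_eventually continuous_map_sum)
    show "\<forall>\<^sub>F n in sequentially. \<forall>x\<in>topspace X. (\<Sum>i. f i x) \<in> UNIV \<and> dist (\<Sum>i<n. f i x) (\<Sum>i. f i x) < e"
      if "e > 0" for e
      using uniform_limitD[OF u that] by auto
  qed auto
  then show ?thesis by simp
qed

text \<open>The set is the preimage, under the curried \<open>F\<close>, of the subbasic set of
  paths that map the compact set \<open>{0..1}\<close> into \<open>U\<close>. This is how a
  condition along a whole path becomes an open condition on the base point.\<close>

lemma tube_open:
  assumes "continuous_map (prod_topology Y unit_interval) X F" "openin X U"
  shows "openin Y {y \<in> topspace Y. \<forall>t\<in>{0..1}. F (y, t) \<in> U}"
proof -
  let ?c = "\<lambda>y. restrict (\<lambda>t. F (y, t)) {0..1}"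
  have c: "continuous_map Y (path_space X) ?c"
    by (rule continuous_map_path_curry[OF assms(1)])
  have "openin Y {y \<in> topspace Y. ?c y \<in> {\<gamma> \<in> paths X. \<gamma> ` {0..1} \<subseteq> U}}"
    by (intro openin_continuous_map_preimage[OF c] openin_path_space_subbasic assms) auto
  moreover have "?c y \<in> paths X" if "y \<in> topspace Y" for y
    using c that unfolding continuous_map_def by auto
  then have "{y \<in> topspace Y. ?c y \<in> {\<gamma> \<in> paths X. \<gamma> ` {0..1} \<subseteq> U}}
    = {y \<in> topspace Y. \<forall>t\<in>{0..1}. F (y, t) \<in> U}"
    by (auto simp: image_subset_iff)
  ultimately show ?thesis by simp
qed

section \<open>Sequence spaces with the product topology\<close>

lemma continuous_map_into_sequences:
  "continuous_map X (euclidean :: (nat \<Rightarrow> real) topology) f \<longleftrightarrow>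
     (\<forall>n. continuous_map X euclideanreal (\<lambda>x. f x n))"
  by (simp flip: euclidean_product_topology add: continuous_map_componentwise_UNIV)

text \<open>The distance of sequences is a weighted sum of coordinate distances capped at 1, so a
  common bound on all coordinates controls it. Distance coordinates are 1-Lipschitz, and one
  estimate in the space then bounds all of them at once.\<close>

lemma open_sequences_uniform_neighbourhood:
  fixes S :: "(nat \<Rightarrow> real) set"
  assumes "open S" "z \<in> S"
  obtains e where "e > 0" "\<And>w. (\<And>n. \<bar>w n - z n\<bar> \<le> e) \<Longrightarrow> w \<in> S"
proof -
  obtain r where r: "r > 0" "ball z r \<subseteq> S"
    using assms open_contains_ball by blast
  show thesis
  \<comment> \<open>The weights \<open>(1/2)^n\<close> sum to 2, so the distance is at most
    \<open>r/2\<close>, strictly below \<open>r\<close>.\<close>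
  proof (rule that[of "r/4"])
    fix w assume w: "\<And>n. \<bar>w n - z n\<bar> \<le> r/4"
    have s: "summable (\<lambda>n. (1/2)^n * (r/4))" "(\<Sum>n. (1/2)^n * (r/4)) = 2 * (r/4)"
      using suminf_mult2[of "\<lambda>n. (1/2::real)^n" "r/4"] suminf_geometric[of "1/2::real"]
      by (auto intro!: summable_mult2 simp: summable_geometric_iff)
    have le: "(1/2)^n * min (dist (z (from_nat n)) (w (from_nat n))) 1 \<le> (1/2)^n * (r/4)" for n
      using w[of "from_nat n"]
      by (intro mult_left_mono min.coboundedI1) (auto simp: dist_real_def abs_minus_commute)
    have "dist z w \<le> (\<Sum>n. (1/2)^n * (r/4))"
      unfolding dist_fun_def using le by (intro suminf_le s summable_comparison_test'[OF s(1)]) auto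
    then show "w \<in> S"
      using r s(2) by auto
  qed (use r in auto)
qed

text \<open>Reals correspond to sets of naturals, and \<open>prod_encode\<close> merges a sequence
  of such sets into a single one. A sequence of reals is thus coded by one real; returning it as a
  constant function works whatever the size of \<open>'a\<close>.\<close>

lemma sequences_lepoll_functions: "\<exists>\<kappa> :: (nat \<Rightarrow> real) \<Rightarrow> ('a \<Rightarrow> real). inj \<kappa>"
proof -
  have "(UNIV :: real set) \<lesssim> (UNIV :: nat set set)" "(UNIV :: nat set set) \<lesssim> (UNIV :: real set)"
    using nat_sets_eqpoll_reals eqpoll_sym eqpoll_imp_lepoll by blast+
  then obtain f :: "real \<Rightarrow> nat set" and g :: "nat set \<Rightarrow> real" where "inj f" "inj g"
    unfolding lepoll_def by blast
  define k where "k = (\<lambda>z :: nat \<Rightarrow> real. g (prod_encode ` {(n, j). j \<in> f (z n)}))"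
  have "inj k"
  proof (rule injI)
    fix x y assume "k x = k y"
    then have "prod_encode ` {(n, j). j \<in> f (x n)} = prod_encode ` {(n, j). j \<in> f (y n)}"
      using \<open>inj g\<close> by (simp add: k_def inj_eq)
    then have "{(n, j). j \<in> f (x n)} = {(n, j). j \<in> f (y n)}"
      by (simp add: inj_image_eq_iff inj_prod_encode)
    then have "f (x n) = f (y n)" for n by blast
    then show "x = y" using \<open>inj f\<close> by (auto simp: inj_eq)
  qed
  then have "inj (\<lambda>z. (\<lambda>_ :: 'a. k z))"
    by (auto simp: inj_def dest: fun_cong)
  then show ?thesis by blast
qed

section \<open>Neighbourhood retractions in sequence spaces\<close>

text \<open>The definition only tests spaces with points in \<open>'a \<Rightarrow> real\<close>; an injection of sequences into this
  type transports the test space.\<close>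

lemma metrizable_ANR_retraction:
  fixes X :: "'a topology" and Z :: "(nat \<Rightarrow> real) topology"
  assumes "metrizable_ANR X" "metrizable_space Z" "embedding_map X Z i" "closedin Z (i ` topspace X)"
  obtains W r where "openin Z W" "i ` topspace X \<subseteq> W" "continuous_map (subtopology Z W) X r"
    "\<And>x. x \<in> topspace X \<Longrightarrow> r (i x) = x"
proof -
  obtain \<kappa> :: "(nat \<Rightarrow> real) \<Rightarrow> ('a \<Rightarrow> real)" where "inj \<kappa>"
    using sequences_lepoll_functions by blast
  \<comment> \<open>Pulling back along the inverse makes \<open>\<kappa>\<close> a homeomorphism
    from \<open>Z\<close> onto a space whose points have the type tested by
    \<open>metrizable_ANR\<close>.\<close>
  define Z' where "Z' = pullback_topology (\<kappa> ` topspace Z) (inv \<kappa>) Z"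
  have "continuous_map Z Z' \<kappa>"
    unfolding Z'_def using \<open>inj \<kappa>\<close> by (intro continuous_map_pullback') auto
  moreover have "continuous_map Z' Z (id \<circ> inv \<kappa>)"
    unfolding Z'_def by (intro continuous_map_pullback) auto
  ultimately have "homeomorphic_maps Z Z' \<kappa> (inv \<kappa>)"
    using \<open>inj \<kappa>\<close> by (auto simp: homeomorphic_maps_def Z'_def topspace_pullback_topology)
  then have \<kappa>: "homeomorphic_map Z Z' \<kappa>"
    using homeomorphic_map_maps by blast
  then have Z': "metrizable_space Z'"
    using assms(2) homeomorphic_map_imp_homeomorphic_space homeomorphic_metrizable_space by blast
  have "embedding_map Z Z' \<kappa>"
    using \<kappa> homeomorphic_imp_surjective_map[OF \<kappa>] by (simp add: embedding_map_def)
  then have emb: "embedding_map X Z' (\<kappa> \<circ> i)"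
    using assms(3) embedding_map_compose by blast
  have "closedin Z' (\<kappa> ` i ` topspace X)"
    using homeomorphic_map_closedness_eq[OF \<kappa>] assms(4) by blast
  then have clo: "closedin Z' ((\<kappa> \<circ> i) ` topspace X)"
    by (simp add: image_comp)
  obtain W' where W': "openin Z' W'" "(\<kappa> \<circ> i) ` topspace X \<subseteq> W'"
      "(\<kappa> \<circ> i) ` topspace X retract_of_space subtopology Z' W'"
    using assms(1) Z' emb clo unfolding metrizable_ANR_def by blast
  then obtain \<rho> where \<rho>: "continuous_map (subtopology Z' W') (subtopology Z' ((\<kappa> \<circ> i) ` topspace X)) \<rho>"
      "\<forall>z\<in>(\<kappa> \<circ> i) ` topspace X. \<rho> z = z"
    unfolding retract_of_space_def
    by (metis continuous_map_in_subtopology continuous_map_into_fulltopology)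
  obtain j where j: "continuous_map (subtopology Z' ((\<kappa> \<circ> i) ` topspace X)) X j"
      "\<forall>x\<in>topspace X. j ((\<kappa> \<circ> i) x) = x"
    using emb unfolding embedding_map_def homeomorphic_map_maps homeomorphic_maps_def by blast
  define W where "W = {z \<in> topspace Z. \<kappa> z \<in> W'}"
  show thesis
  proof (rule that[of W "j \<circ> \<rho> \<circ> \<kappa>"])
    have c\<kappa>: "continuous_map Z Z' \<kappa>"
      using \<kappa> by (simp add: homeomorphic_imp_continuous_map)
    then show "openin Z W"
      unfolding W_def using W'(1) by (rule openin_continuous_map_preimage)
    have "i x \<in> topspace Z" if "x \<in> topspace X" for x
      using closedin_subset[OF assms(4)] that by blast
    then show "i ` topspace X \<subseteq> W"
      using W'(2) by (auto simp: W_def)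
    have "continuous_map (subtopology Z W) (subtopology Z' W') \<kappa>"
      using c\<kappa> by (auto simp: W_def continuous_map_in_subtopology continuous_map_from_subtopology)
    then show "continuous_map (subtopology Z W) X (j \<circ> \<rho> \<circ> \<kappa>)"
      using \<rho>(1) j(1) by (metis continuous_map_compose comp_assoc)
    show "(j \<circ> \<rho> \<circ> \<kappa>) (i x) = x" if "x \<in> topspace X" for x
      using that \<rho>(2) j(2) by simp
  qed
qed

text \<open>Kuratowski-style distance coordinates, with \<open>q\<close> meant to enumerate a dense
  set. They are shifted by one because coordinate 0 is reserved for the height in
  \<open>collar\<close>.\<close>

definition metric_coords :: "'a metric \<Rightarrow> (nat \<Rightarrow> 'a) \<Rightarrow> 'a \<Rightarrow> nat \<Rightarrow> real" where
  "metric_coords m q x = case_nat 0 (\<lambda>k. mdist m x (q k))"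

definition collar :: "'a metric \<Rightarrow> (nat \<Rightarrow> 'a) \<Rightarrow> (nat \<Rightarrow> real) set" where
  "collar m q = {z. 0 < z 0} \<union> metric_coords m q ` mspace m"

lemma metric_coords_simps [simp]:
  "metric_coords m q x 0 = 0" "metric_coords m q x (Suc k) = mdist m x (q k)"
  by (auto simp: metric_coords_def)

lemma continuous_map_metric_coords:
  assumes "range q \<subseteq> mspace m"
  shows "continuous_map (mtopology_of m) euclidean (metric_coords m q)"
  unfolding continuous_map_into_sequences
proof
  fix n
  have "continuous_map (mtopology_of m) euclideanreal (\<lambda>x. mdist m x (q k))" for k
    using assms by (intro continuous_map_mdist) auto
  then show "continuous_map (mtopology_of m) euclideanreal (\<lambda>x. metric_coords m q x n)"
    by (cases n) auto
qed

text \<open>At each point a single coordinate suffices: if \<open>q k\<close> is within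
  \<open>r/2\<close> of \<open>x\<close>, then every \<open>y\<close> whose coordinate
  \<open>Suc k\<close> is below \<open>r/2\<close> is within \<open>r\<close> of \<open>x\<close>.
  This yields both injectivity and openness onto the image.\<close>

lemma embedding_map_metric_coords:
  assumes q: "range q \<subseteq> mspace m"
    and dense: "\<And>x e. x \<in> mspace m \<Longrightarrow> e > 0 \<Longrightarrow> \<exists>k. mdist m x (q k) < e"
    and Z: "metric_coords m q ` mspace m \<subseteq> Z"
  shows "embedding_map (mtopology_of m) (top_of_set Z) (metric_coords m q)"
  unfolding embedding_map_def
proof (rule bijective_open_imp_homeomorphic_map)
  let ?i = "metric_coords m q"
  let ?Y = "subtopology (top_of_set Z) (?i ` topspace (mtopology_of m))"
  have Y: "?Y = top_of_set (?i ` mspace m)"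
    by (simp add: subtopology_subtopology Int_absorb1[OF Z])
  show "continuous_map (mtopology_of m) ?Y ?i"
    unfolding Y by (intro continuous_map_into_subtopology continuous_map_metric_coords q) auto
  show "?i ` topspace (mtopology_of m) = topspace ?Y"
    unfolding Y by simp
  have near: "\<exists>k e. mdist m x (q k) < e \<and> (\<forall>y\<in>mspace m. mdist m y (q k) < e \<longrightarrow> mdist m x y < r)"
    if xr: "x \<in> mspace m" "r > 0" for x r
  proof -
    obtain k where k: "mdist m x (q k) < r/2"
      using dense[of x "r/2"] xr by auto
    have "mdist m x y < r" if "y \<in> mspace m" "mdist m y (q k) < r/2" for y
      using k that mdist_triangle[of x m "q k" y] \<open>x \<in> mspace m\<close> q mdist_commute[of m y "q k"] by fastforce
    with k show ?thesis by blast
  qed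
  show "inj_on ?i (topspace (mtopology_of m))"
  proof (rule inj_onI, simp)
    fix x y assume xy: "x \<in> mspace m" "y \<in> mspace m" "?i x = ?i y"
    have "mdist m x y < r" if "r > 0" for r
      using near[OF xy(1) that] xy by (metis metric_coords_simps(2))
    then have "mdist m x y \<le> 0" using linorder_not_le by blast
    then show "x = y"
      using mdist_nonneg[of m x y] xy mdist_zero[of x m y] by auto
  qed
  show "open_map (mtopology_of m) ?Y ?i"
    unfolding open_map_def Y
  proof (intro allI impI)
    fix U assume U: "openin (mtopology_of m) U"
    show "openin (top_of_set (?i ` mspace m)) (?i ` U)"
    proof (subst openin_subopen, intro ballI)
      fix z assume "z \<in> ?i ` U"
      then obtain x where x: "x \<in> U" "z = ?i x" by blast
      then obtain r where r: "r > 0" "\<And>y. y \<in> mspace m \<Longrightarrow> mdist m x y < r \<Longrightarrow> y \<in> U" "x \<in> mspace m"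
        using U unfolding openin_mtopology_of by blast
      obtain k e where ke: "mdist m x (q k) < e" "\<forall>y\<in>mspace m. mdist m y (q k) < e \<longrightarrow> mdist m x y < r"
        using near[OF r(3,1)] by blast
      have "open {w :: nat \<Rightarrow> real. w (Suc k) < e}"
        by (intro open_Collect_less continuous_intros continuous_on_product_coordinates)
      then have "openin (top_of_set (?i ` mspace m)) (?i ` mspace m \<inter> {w. w (Suc k) < e})"
        by (rule openin_open_Int)
      moreover have "z \<in> ?i ` mspace m \<inter> {w. w (Suc k) < e}"
        using x r ke by auto
      moreover have "?i ` mspace m \<inter> {w. w (Suc k) < e} \<subseteq> ?i ` U"
        using r ke by auto
      ultimately show "\<exists>T. openin (top_of_set (?i ` mspace m)) T \<and> z \<in> T \<and> T \<subseteq> ?i ` U"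
        by blast
    qed
  qed
qed

text \<open>The positive zeroth coordinate makes a closed embedding out of the coordinate map, while all
  sequences with positive zeroth coordinate remain available for interpolation.\<close>

lemma metrizable_ANR_coordinates:
  fixes X :: "'a topology"
  assumes "metrizable_ANR X" "separable_space X" "topspace X \<noteq> {}"
  obtains m q W r where "X = mtopology_of m" "\<And>x y. mdist m x y \<le> 1" "range q \<subseteq> mspace m"
    "open W" "continuous_map (top_of_set (collar m q \<inter> W)) X r"
    "\<And>x. x \<in> mspace m \<Longrightarrow> metric_coords m q x \<in> W \<and> r (metric_coords m q x) = x"
proof -
  obtain m where m: "X = mtopology_of m" "\<And>x y. mdist m x y \<le> 1"
    using assms(1) metrizable_space_bounded_metric unfolding metrizable_ANR_def by blast
  obtain C where C: "countable C" "C \<subseteq> mspace m" "X closure_of C = mspace m"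
    using assms(2) m unfolding separable_space_def by auto
  then have "C \<noteq> {}"
    using assms(3) m by auto
  define q where "q = from_nat_into C"
  have range_q: "range q = C"
    using C \<open>C \<noteq> {}\<close> by (simp add: q_def)
  interpret Metric_space "mspace m" "mdist m" by simp
  have dense: "\<exists>k. mdist m x (q k) < e" if "x \<in> mspace m" "e > 0" for x e
  proof -
    have "x \<in> mtopology closure_of C"
      using C(3) that m by (auto simp: mtopology_of_def)
    then obtain y where "y \<in> C" "mdist m x y < e"
      unfolding metric_closure_of using \<open>e > 0\<close> by auto
    then show ?thesis using range_q by auto
  qed
  let ?i = "metric_coords m q"
  have q: "range q \<subseteq> mspace m" using range_q C by simp
  have emb: "embedding_map X (top_of_set (collar m q)) ?i"
    unfolding m(1) using q dense by (rule embedding_map_metric_coords) (auto simp: collar_def)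
  have "closed {z :: nat \<Rightarrow> real. z 0 \<le> 0}"
    by (intro closed_Collect_le continuous_intros continuous_on_product_coordinates)
  then have "closedin (top_of_set (collar m q)) (collar m q \<inter> {z. z 0 \<le> 0})"
    by (rule closedin_closed_Int)
  moreover have "collar m q \<inter> {z. z 0 \<le> 0} = ?i ` topspace X"
    by (auto simp: collar_def m)
  ultimately have clo: "closedin (top_of_set (collar m q)) (?i ` topspace X)"
    by simp
  have "metrizable_space (top_of_set (collar m q))"
    by (intro metrizable_space_subtopology metrizable_space_euclidean)
  from metrizable_ANR_retraction[OF assms(1) this emb clo]
  obtain V r where V: "openin (top_of_set (collar m q)) V" "?i ` topspace X \<subseteq> V"
     "continuous_map (subtopology (top_of_set (collar m q)) V) X r"
     "\<And>x. x \<in> topspace X \<Longrightarrow> r (?i x) = x"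
    by blast
  then obtain W where W: "open W" "V = collar m q \<inter> W"
    unfolding openin_open by auto
  show thesis
    by (rule that[OF m q W(1)]) (use V W in \<open>auto simp: subtopology_subtopology m\<close>)
qed

section \<open>Local equiconnectedness and approximate extension\<close>

lemma continuous_map_fst_apply:
  "continuous_map Z (prod_topology X Y) f \<Longrightarrow> continuous_map Z X (\<lambda>x. fst (f x))"
  and continuous_map_snd_apply:
  "continuous_map Z (prod_topology X Y) f \<Longrightarrow> continuous_map Z Y (\<lambda>x. snd (f x))"
  using continuous_map_fst_of continuous_map_snd_of by (force simp: o_def)+

lemma continuous_map_prod_subtopology:
  assumes "continuous_map (prod_topology Y T) X H"
  shows "continuous_map (prod_topology (subtopology Y S) T) X H"
  unfolding prod_topology_subtopology(1)[of Y S T] using assms by (rule continuous_map_from_subtopology)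

lemma mdist_self: "x \<in> mspace m \<Longrightarrow> mdist m x x = 0"
  by simp

text \<open>A path between coordinate vectors is written down in the collar and retracted to
  \<open>X\<close>; \<open>N\<close> consists of the pairs whose path stays in the domain of the
  retraction. The number \<open>\<delta> (x, y)\<close> is an arrival time after which the path
  rests at \<open>y\<close>. As it vanishes on the diagonal, the path from \<open>x\<close> to
  \<open>x\<close> is constant. The continuous arrival time is what later makes lifted transport
  regular.\<close>

lemma metrizable_ANR_locally_equiconnected:
  fixes X :: "'a topology"
  assumes "metrizable_ANR X" "separable_space X" "topspace X \<noteq> {}"
  obtains N \<delta> \<mu> where "openin (prod_topology X X) N" "\<And>x. x \<in> topspace X \<Longrightarrow> (x, x) \<in> N"
    "continuous_map (prod_topology X X) unit_interval \<delta>" "\<And>x. x \<in> topspace X \<Longrightarrow> \<delta> (x, x) = 0"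
    "continuous_map (prod_topology (subtopology (prod_topology X X) N) unit_interval) X \<mu>"
    "\<And>x y. (x, y) \<in> N \<Longrightarrow> \<mu> ((x, y), 0) = x"
    "\<And>x y t. (x, y) \<in> N \<Longrightarrow> \<delta> (x, y) \<le> t \<Longrightarrow> t \<le> 1 \<Longrightarrow> \<mu> ((x, y), t) = y"
proof -
  obtain m q W r where m: "X = mtopology_of m" "\<And>x y. mdist m x y \<le> 1" and q: "range q \<subseteq> mspace m"
    and W: "open W" and r: "continuous_map (top_of_set (collar m q \<inter> W)) X r"
    and ri: "\<And>x. x \<in> mspace m \<Longrightarrow> metric_coords m q x \<in> W \<and> r (metric_coords m q x) = x"
    using metrizable_ANR_coordinates[OF assms] by blast
  define \<delta> where "\<delta> = (\<lambda>(x, y). mdist m x y)"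
  \<comment> \<open>Each coordinate moves from that of \<open>x\<close> towards that of \<open>y\<close> at unit speed and stops there. The
    coordinates are 1-Lipschitz, so all have arrived at time \<open>mdist m x y\<close>; strictly before that the
    zeroth coordinate is positive, which keeps the path in the collar.\<close>
  define \<kappa> where "\<kappa> = (\<lambda>((x, y), t). case_nat (max 0 (min t (mdist m x y - t)))
      (\<lambda>k. mdist m x (q k) + max (- t) (min t (mdist m y (q k) - mdist m x (q k)))))"
  let ?P = "prod_topology X X"
  let ?PI = "prod_topology ?P unit_interval"
  have c0: "continuous_map ?PI X (\<lambda>z. fst (fst z))" "continuous_map ?PI X (\<lambda>z. snd (fst z))"
     "continuous_map ?PI euclideanreal (\<lambda>z. snd z)"
    using continuous_map_fst[of ?P unit_interval] continuous_map_snd[of ?P unit_interval]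
    by (auto intro: continuous_map_fst_apply continuous_map_snd_apply simp: continuous_map_in_subtopology)
  have c\<kappa>: "continuous_map ?PI euclidean \<kappa>"
    unfolding continuous_map_into_sequences
  proof
    fix n
    have *: "continuous_map ?PI X (\<lambda>z. q k)" for k
      using q m by auto
    have "continuous_map ?PI euclideanreal (\<lambda>z. max 0 (min (snd z) (mdist m (fst (fst z)) (snd (fst z)) - snd z)))"
      by (intro continuous_intros c0[unfolded m] c0(3)) (use c0 m in auto)
    moreover have "continuous_map ?PI euclideanreal (\<lambda>z. mdist m (fst (fst z)) (q k)
       + max (- snd z) (min (snd z) (mdist m (snd (fst z)) (q k) - mdist m (fst (fst z)) (q k))))" for k
      by (intro continuous_intros c0[unfolded m] c0(3)) (use c0 m * in auto)
    ultimately show "continuous_map ?PI euclideanreal (\<lambda>z. \<kappa> z n)"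
      by (cases n) (auto simp: \<kappa>_def case_prod_unfold)
  qed
  have \<kappa>0: "\<kappa> ((x, y), 0) = metric_coords m q x" if "x \<in> mspace m" "y \<in> mspace m" for x y
  proof
    fix n show "\<kappa> ((x, y), 0) n = metric_coords m q x n"
      by (cases n) (auto simp: \<kappa>_def)
  qed
  have clamp: "max (- t) (min t u) = u" if "\<bar>u\<bar> \<le> t" for t u :: real
    using that by auto
  have \<kappa>1: "\<kappa> ((x, y), t) = metric_coords m q y" if "x \<in> mspace m" "y \<in> mspace m" "mdist m x y \<le> t" for x y t
  proof
    fix n
    have "\<bar>mdist m y (q k) - mdist m x (q k)\<bar> \<le> t" for k
      using mdist_triangle[of x m y "q k"] mdist_triangle[of y m x "q k"] that range_subsetD[OF q, of k]
      by (auto simp: mdist_commute)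
    then have "max (- t) (min t (mdist m y (q k) - mdist m x (q k))) = mdist m y (q k) - mdist m x (q k)" for k
      by (intro clamp)
    then show "\<kappa> ((x, y), t) n = metric_coords m q y n"
      using that mdist_nonneg[of m x y] by (cases n) (auto simp: \<kappa>_def)
  qed
  have \<kappa>c: "\<kappa> ((x, y), t) \<in> collar m q" if "x \<in> mspace m" "y \<in> mspace m" "t \<in> {0..1}" for x y t
  proof (cases "t = 0 \<or> mdist m x y \<le> t")
    case True
    then show ?thesis
      using \<kappa>0[of x y] \<kappa>1[of x y t] that by (auto simp: collar_def)
  next
    case False
    then have "\<kappa> ((x, y), t) 0 > 0"
      using that by (auto simp: \<kappa>_def)
    then show ?thesis by (simp add: collar_def)
  qed
  define N where "N = {z \<in> topspace ?P. \<forall>t\<in>{0..1}. \<kappa> (z, t) \<in> W}"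
  show thesis
  proof (rule that[of N \<delta> "r \<circ> \<kappa>"])
    show "openin ?P N"
      unfolding N_def using W by (intro tube_open[OF c\<kappa>]) auto
    show "(x, x) \<in> N" if "x \<in> topspace X" for x
      using that m \<kappa>1[of x x] ri[of x] by (auto simp: N_def mdist_self)
    show "continuous_map ?P unit_interval \<delta>"
      using m continuous_map_mdist[of ?P m fst snd]
      by (auto simp: \<delta>_def continuous_map_in_subtopology case_prod_unfold continuous_map_fst continuous_map_snd)
    show "\<delta> (x, x) = 0" if "x \<in> topspace X" for x
      using that m by (simp add: \<delta>_def mdist_self)
    have "continuous_map (prod_topology (subtopology ?P N) unit_interval) euclidean \<kappa>"
      by (rule continuous_map_prod_subtopology[OF c\<kappa>])
    then have "continuous_map (prod_topology (subtopology ?P N) unit_interval) (top_of_set (collar m q \<inter> W)) \<kappa>"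
      using \<kappa>c m by (auto simp: continuous_map_in_subtopology N_def)
    then show "continuous_map (prod_topology (subtopology ?P N) unit_interval) X (r \<circ> \<kappa>)"
      using r by (rule continuous_map_compose)
    show "(r \<circ> \<kappa>) ((x, y), 0) = x" if "(x, y) \<in> N" for x y
      using that \<kappa>0[of x y] ri m by (auto simp: N_def)
    show "(r \<circ> \<kappa>) ((x, y), t) = y" if "(x, y) \<in> N" "\<delta> (x, y) \<le> t" "t \<le> 1" for x y t
      using that \<kappa>1[of x y t] ri m by (auto simp: N_def \<delta>_def)
  qed
qed

section \<open>Approximate extension from an arbitrary separable subset\<close>

text \<open>Dugundji's averaging, carried out on coordinates in sequence space and followed by the
  retraction \<open>r\<close>. Since \<open>A\<close> need not be closed, agreement with
  \<open>h\<close> on \<open>A\<close> is replaced by membership in \<open>R\<close>. The average is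
  defined wherever some weight is positive, and the other requirements are open, so all of them need
  checking only at points of \<open>A\<close>.\<close>

lemma metrizable_ANR_approximate_extension:
  fixes X :: "'a topology" and Y :: "'c topology"
  assumes ANR: "metrizable_ANR X" "separable_space X"
    and Y: "metrizable_space Y" "separable_space (subtopology Y A)" and A: "A \<subseteq> topspace Y"
    and h: "continuous_map (subtopology Y A) X h"
    and R: "openin (prod_topology Y X) R" and hR: "\<And>a. a \<in> A \<Longrightarrow> (a, h a) \<in> R"
  obtains V g where "openin Y V" "A \<subseteq> V" "continuous_map (subtopology Y V) X g"
    "\<And>y. y \<in> V \<Longrightarrow> (y, g y) \<in> R"
proof (cases "A = {}")
  case True
  then show thesis
    by (intro that[of "{}"]) auto
next
  case False
  have hX: "h a \<in> topspace X" if "a \<in> A" for a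
    using h A that by (auto simp: continuous_map_def Pi_iff)
  then have "topspace X \<noteq> {}"
    using False by auto
  then obtain m q W r where m: "X = mtopology_of m" "\<And>x y. mdist m x y \<le> 1" and q: "range q \<subseteq> mspace m"
    and W: "open W" and r: "continuous_map (top_of_set (collar m q \<inter> W)) X r"
    and ri: "\<And>x. x \<in> mspace m \<Longrightarrow> metric_coords m q x \<in> W \<and> r (metric_coords m q x) = x"
    using metrizable_ANR_coordinates[OF ANR] by blast
  obtain n where n: "Y = mtopology_of n" "\<And>x y. mdist n x y \<le> 1"
    using metrizable_space_bounded_metric[OF Y(1)] by blast
  have An: "A \<subseteq> mspace n" using A n by simp
  obtain C where C: "countable C" "C \<subseteq> A" "subtopology Y A closure_of C = A"
    using Y(2) A unfolding separable_space_def by (auto simp: inf.absorb2)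
  then have "C \<noteq> {}" using False by auto
  define b where "b = from_nat_into C"
  have range_b: "range b = C"
    using C \<open>C \<noteq> {}\<close> by (simp add: b_def)
  then have bA: "b k \<in> A" for k using C by blast
  interpret n: Metric_space "mspace n" "mdist n" by simp
  have dense: "\<exists>k. mdist n a (b k) < e" if "a \<in> A" "e > 0" for a e
  proof -
    have "a \<in> n.mtopology closure_of C"
      using C(3) that n closure_of_mono[of "A \<inter> C" C n.mtopology]
      by (auto simp: mtopology_of_def closure_of_subtopology)
    then obtain y where "y \<in> C" "mdist n a y < e"
      unfolding n.metric_closure_of using \<open>e > 0\<close> by auto
    then show ?thesis using range_b by auto
  qed

  let ?c = "\<lambda>a. metric_coords m q (h a)"
  define Q where "Q = {(y, z). z \<in> W \<and> (y, r z) \<in> R}"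
  \<comment> \<open>\<open>between a d z\<close>: \<open>z\<close> lies in the closed coordinatewise convex hull of the values of \<open>h\<close> on the
    \<open>d\<close>-ball around \<open>a\<close>, pushed into the collar by less than \<open>d\<close>.\<close>
  define between where "between a d z \<longleftrightarrow> 0 < z 0 \<and> z 0 < d \<and>
      (\<forall>k c e. (\<forall>a'\<in>A. mdist n a a' < d \<longrightarrow> \<bar>?c a' (Suc k) - c\<bar> \<le> e) \<longrightarrow> \<bar>z (Suc k) - c\<bar> \<le> e)"
    for a d and z :: "nat \<Rightarrow> real"
  \<comment> \<open>Admissibility is demanded for every \<open>x\<close> of \<open>A\<close> in the
    ball, not only for its centre. By the triangle inequality it then passes to smaller balls around
    nearby centres, which gives the Lipschitz property of the best radius.\<close>
  define good where "good a d \<longleftrightarrow>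
      (\<forall>x\<in>A. mdist n a x < d \<longrightarrow> (\<forall>z. between a d z \<longrightarrow> (x, z) \<in> Q))" for a d
  have good_mono: "good x d'" if "good a d" "x \<in> A" "a \<in> A" "d' + mdist n a x \<le> d" for a d x d'
  proof -
    have sub: "mdist n a y < d" if "mdist n x y < d'" "y \<in> A" for y
      using that \<open>x \<in> A\<close> \<open>a \<in> A\<close> \<open>d' + mdist n a x \<le> d\<close> subsetD[OF An] mdist_triangle[of a n x y]
      by fastforce
    have "between a d z" if "between x d' z" for z
    proof -
      have "d' \<le> d"
        using \<open>d' + mdist n a x \<le> d\<close> mdist_nonneg[of n a x] by linarith
      with that sub show ?thesis
        unfolding between_def by (meson less_le_trans)
    qed
    then show ?thesis
      using \<open>good a d\<close> sub unfolding good_def by blast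
  qed
  have good_ex: "\<exists>d>0. d \<le> 1 \<and> good a d" if a: "a \<in> A" for a
  proof -
    let ?T = "top_of_set (collar m q \<inter> W)"
    have "continuous_map (prod_topology Y ?T) (prod_topology Y X) (\<lambda>(y, z). (y, r z))"
      using r by (intro continuous_map_prod_top[of Y ?T Y X id r, simplified, THEN iffD2]) auto
    then have "openin (prod_topology Y ?T) {p \<in> topspace (prod_topology Y ?T). (\<lambda>(y, z). (y, r z)) p \<in> R}" (is "openin _ ?G")
      using R by (rule openin_continuous_map_preimage)
    moreover have "(a, ?c a) \<in> ?G"
      using a A hX[OF a] ri[of "h a"] hR[OF a] m by (auto simp: collar_def)
    ultimately obtain S T where ST: "openin Y S" "openin ?T T" "a \<in> S" "?c a \<in> T" "S \<times> T \<subseteq> ?G"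
      unfolding openin_prod_topology_alt by meson
    obtain T' where T': "open T'" "T = collar m q \<inter> W \<inter> T'"
      using ST(2) unfolding openin_open by auto
    obtain d1 where d1: "d1 > 0" "\<And>y. y \<in> mspace n \<Longrightarrow> mdist n a y < d1 \<Longrightarrow> y \<in> S"
      using ST(1,3) unfolding n(1) openin_mtopology_of by blast
    obtain e where e: "e > 0" "\<And>w. (\<And>k. \<bar>w k - ?c a k\<bar> \<le> e) \<Longrightarrow> w \<in> W \<inter> T'"
      using open_sequences_uniform_neighbourhood[of "W \<inter> T'" "?c a"] W T' ST(4) by blast
    have "openin X {x \<in> topspace X. mdist m x (h a) < e}"
    proof -
      have "continuous_map X euclideanreal (\<lambda>x. mdist m x (h a))"
        using hX[OF a] unfolding m(1) by (intro continuous_map_mdist) auto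
      from openin_continuous_map_preimage[OF this, of "{..<e}"] show ?thesis by simp
    qed
    then have "openin (subtopology Y A) {y \<in> topspace (subtopology Y A). h y \<in> {x \<in> topspace X. mdist m x (h a) < e}}"
      by (rule openin_continuous_map_preimage[OF h])
    then obtain O' where O': "openin Y O'" "{y \<in> topspace (subtopology Y A). h y \<in> {x \<in> topspace X. mdist m x (h a) < e}} = O' \<inter> A"
      unfolding openin_subtopology by blast
    have "a \<in> {y \<in> topspace (subtopology Y A). h y \<in> {x \<in> topspace X. mdist m x (h a) < e}}"
      using a A hX[OF a] e m by (auto simp: mdist_self)
    then have "a \<in> O'"
      using O'(2) by blast
    then obtain d2 where d2: "d2 > 0" "\<And>y. y \<in> mspace n \<Longrightarrow> mdist n a y < d2 \<Longrightarrow> y \<in> O'"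
      using O'(1) unfolding n(1) openin_mtopology_of by blast
    \<comment> \<open>\<open>d1\<close> keeps the base point in \<open>S\<close>, \<open>d2\<close>
      keeps the coordinates of \<open>h\<close> within \<open>e\<close>, \<open>e\<close> bounds the
      height, and 1 keeps the set of admissible radii bounded.\<close>
    define d where "d = min (min d1 d2) (min e 1)"
    have "good a d"
      unfolding good_def
    proof (intro ballI allI impI)
      fix x z assume x: "x \<in> A" "mdist n a x < d" and z: "between a d z"
      have "\<bar>?c a' (Suc k) - ?c a (Suc k)\<bar> \<le> e" if "a' \<in> A" "mdist n a a' < d" for a' k
      proof -
        have "a' \<in> O'"
          using d2(2)[of a'] that An by (auto simp: d_def)
        then have "mdist m (h a') (h a) < e"
          using O'(2) that(1) by blast
        moreover have "\<bar>mdist m (h a') (q k) - mdist m (h a) (q k)\<bar> \<le> mdist m (h a') (h a)"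
          using mdist_triangle[of "h a'" m "h a" "q k"] mdist_triangle[of "h a" m "h a'" "q k"]
            hX[OF a] hX[OF that(1)] range_subsetD[OF q, of k] m(1) by (auto simp: mdist_commute)
        ultimately show ?thesis by simp
      qed
      then have "\<bar>z (Suc k) - ?c a (Suc k)\<bar> \<le> e" for k
        using z unfolding between_def by blast
      moreover have "\<bar>z 0 - ?c a 0\<bar> \<le> e"
        using z by (auto simp: between_def d_def)
      ultimately have "z \<in> W \<inter> T'"
        using e(2)[of z] by (metis nat.exhaust)
      moreover have "z \<in> collar m q"
        using z by (simp add: between_def collar_def)
      moreover have "x \<in> S"
        using d1(2)[of x] x An by (auto simp: d_def)
      ultimately show "(x, z) \<in> Q"
        using ST(5) T'(2) by (auto simp: Q_def)
    qed
    moreover have "d > 0" "d \<le> 1"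
      using d1 d2 e by (auto simp: d_def)
    ultimately show ?thesis by blast
  qed

  \<comment> \<open>The best radius is 1-Lipschitz, so balls of a quarter of it that meet have comparable radii.
    This makes every weighted average of values at nearby centres admissible.\<close>
  define \<rho> where "\<rho> a = Sup {d. 0 < d \<and> d \<le> 1 \<and> good a d}" for a
  have bdd: "bdd_above {d. 0 < d \<and> d \<le> 1 \<and> good a d}" for a
    by (rule bdd_aboveI[of _ 1]) auto
  have \<rho>_pos: "0 < \<rho> a" if "a \<in> A" for a
  proof -
    obtain d where "d > 0" "d \<le> 1" "good a d"
      using good_ex[OF \<open>a \<in> A\<close>] by blast
    then have "d \<le> \<rho> a"
      unfolding \<rho>_def by (intro cSup_upper bdd) auto
    with \<open>d > 0\<close> show ?thesis by linarith
  qed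
  have \<rho>_le: "\<rho> a \<le> 1" if "a \<in> A" for a
    using good_ex[OF that] unfolding \<rho>_def by (intro cSup_least) auto
  have \<rho>_good: "good a d" if "a \<in> A" "d < \<rho> a" for a d
  proof -
    obtain d' where "d' \<in> {d. 0 < d \<and> d \<le> 1 \<and> good a d}" "d < d'"
      using \<open>d < \<rho> a\<close> good_ex[OF \<open>a \<in> A\<close>] unfolding \<rho>_def
      by (subst (asm) less_cSup_iff[OF _ bdd]) auto
    then show ?thesis
      using good_mono[of a d' a d] \<open>a \<in> A\<close> An mdist_self[of a n] by auto
  qed
  have \<rho>_Lip: "\<rho> a - mdist n a x \<le> \<rho> x" if "a \<in> A" "x \<in> A" for a x
  proof (rule ccontr)
    assume "\<not> ?thesis"
    then obtain d where d: "\<rho> x < d" "d < \<rho> a - mdist n a x"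
      using dense_order_class.dense linorder_not_le by blast
    then have "good a (d + mdist n a x)"
      using \<rho>_good[OF that(1)] by simp
    then have "good x d"
      using good_mono that by simp
    moreover have "0 < d" "d \<le> 1"
      using d \<rho>_pos[OF that(2)] \<rho>_le[OF that(1)] mdist_nonneg[of n a x] by linarith+
    ultimately have "d \<le> \<rho> x"
      unfolding \<rho>_def by (intro cSup_upper bdd) auto
    with d show False by simp
  qed

  \<comment> \<open>Tents of radius \<open>\<rho> (b k) / 4\<close> around a dense sequence of
    \<open>A\<close>. The factors \<open>(1/2)^Suc k\<close> sum to 1 and give uniform convergence,
    in place of a locally finite partition of unity.\<close>
  define w where "w k y = (1/2)^Suc k * max 0 (\<rho> (b k) / 4 - mdist n (b k) y)" for k y
  have w_nonneg: "0 \<le> w k y" for k y by (simp add: w_def)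
  have geo: "summable (\<lambda>k. (1/2::real)^Suc k)" "(\<Sum>k. (1/2::real)^Suc k) = 1"
    using power_half_series by (auto simp: sums_iff)
  have w_le: "w k y \<le> (1/2)^Suc k" for k y
  proof -
    have "max 0 (\<rho> (b k) / 4 - mdist n (b k) y) \<le> 1"
      using \<rho>_le[OF bA[of k]] mdist_nonneg[of n "b k" y] by linarith
    then show ?thesis
      unfolding w_def by (simp add: mult_left_le)
  qed
  have w_sum: "summable (\<lambda>k. w k y)" for y
    by (rule summable_comparison_test'[OF geo(1)]) (use w_le w_nonneg in auto)
  have cw: "continuous_map Y euclideanreal (w k)" for k
    unfolding w_def[abs_def] n(1)
    by (intro continuous_intros continuous_map_id[unfolded id_def]) (use bA An in auto)
  define S where "S y = (\<Sum>k. w k y)" for y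
  have cS: "continuous_map Y euclideanreal S"
    unfolding S_def[abs_def] by (rule continuous_map_suminf[OF cw _ geo(1)]) (use w_le w_nonneg in auto)
  define F where "F k y = (\<Sum>j. w j y * ?c (b j) (Suc k))" for k y
  have F_le: "\<bar>w j y * ?c (b j) (Suc k)\<bar> \<le> w j y" for j k y
    using w_nonneg[of j y] m(2) mdist_nonneg by (simp add: abs_mult mult_left_le)
  have F_sum: "summable (\<lambda>j. w j y * ?c (b j) (Suc k))" for k y
    by (rule summable_comparison_test'[OF w_sum[of y]]) (use F_le in auto)
  have cF: "continuous_map Y euclideanreal (F k)" for k
    unfolding F_def[abs_def]
  proof (rule continuous_map_suminf[OF _ _ geo(1)])
    show "continuous_map Y euclideanreal (\<lambda>y. w j y * ?c (b j) (Suc k))" for j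
      by (rule continuous_map_real_mult_right[OF cw])
    show "\<bar>w j y * ?c (b j) (Suc k)\<bar> \<le> (1/2)^Suc j" for j y
      using F_le w_le by (rule order_trans)
  qed
  \<comment> \<open>The total weight \<open>S y\<close> itself serves as the height. It is positive
    on \<open>V'\<close>, so \<open>z y\<close> lies in the collar there whatever its other
    coordinates are.\<close>
  define z where "z y = case_nat (S y) (\<lambda>k. F k y / S y)" for y
  define V' where "V' = {y \<in> topspace Y. S y \<in> {0<..}}"
  have V': "openin Y V'"
    unfolding V'_def by (rule openin_continuous_map_preimage[OF cS]) simp
  have cz: "continuous_map (subtopology Y V') euclidean z"
    unfolding continuous_map_into_sequences
  proof
    fix k
    have "continuous_map (subtopology Y V') euclideanreal (\<lambda>y. F k y / S y)" for k
      by (intro continuous_map_real_divide continuous_map_from_subtopology cF cS) (auto simp: V'_def)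
    then show "continuous_map (subtopology Y V') euclideanreal (\<lambda>y. z y k)"
      using continuous_map_from_subtopology[OF cS] by (cases k) (auto simp: z_def)
  qed
  have S_pos: "S a > 0" if a: "a \<in> A" for a
  proof -
    \<comment> \<open>The Lipschitz bound gives \<open>\<rho> (b k) > 7/8 * \<rho> a\<close>, and a
      quarter of this exceeds \<open>\<rho> a / 8\<close>; hence \<open>a\<close> lies inside the
      tent around \<open>b k\<close>.\<close>
    obtain k where k: "mdist n a (b k) < \<rho> a / 8"
      using dense[OF a, of "\<rho> a / 8"] \<rho>_pos[OF a] by auto
    then have "\<rho> (b k) / 4 - mdist n (b k) a > 0"
      using \<rho>_Lip[OF a bA[of k]] \<rho>_pos[OF a] mdist_commute[of n a "b k"] by linarith
    then have "w k a > 0"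
      by (simp add: w_def)
    then show ?thesis
      unfolding S_def using w_sum w_nonneg suminf_pos_iff by blast
  qed
  \<comment> \<open>A contributing centre is closer than \<open>\<rho> (b k) / 4\<close>, so the
    Lipschitz bound gives \<open>3/4 * \<rho> (b k) < \<rho> a\<close>. This is the origin of the
    third.\<close>
  have contrib: "mdist n a (b k) < \<rho> a / 3 \<and> \<rho> (b k) / 4 \<le> \<rho> a / 3" if "a \<in> A" "w k a \<noteq> 0" for a k
  proof -
    have "mdist n (b k) a < \<rho> (b k) / 4"
      using that(2) by (auto simp: w_def max_def split: if_splits)
    then show ?thesis
      using \<rho>_Lip[OF bA[of k] that(1)] mdist_commute[of n a "b k"] by auto
  qed
  have zQ: "(a, z a) \<in> Q" if a: "a \<in> A" for a
  proof -
    have S_le: "S a \<le> \<rho> a / 3"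
    proof -
      have "w k a \<le> (1/2)^Suc k * (\<rho> a / 3)" for k
      proof (cases "w k a = 0")
        case True then show ?thesis using \<rho>_pos[OF a] by simp
      next
        case False
        have "max 0 (\<rho> (b k) / 4 - mdist n (b k) a) \<le> \<rho> a / 3"
          using contrib[OF a False] \<rho>_pos[OF a] mdist_nonneg[of n "b k" a] by linarith
        then show ?thesis unfolding w_def by (intro mult_left_mono) auto
      qed
      then have "S a \<le> (\<Sum>k. (1/2)^Suc k * (\<rho> a / 3))"
        unfolding S_def by (intro suminf_le w_sum summable_mult2 geo)
      also have "\<dots> = \<rho> a / 3"
        using suminf_mult2[OF geo(1), of "\<rho> a / 3"] geo(2) by simp
      finally show ?thesis .
    qed
    have "\<bar>F k a / S a - c\<bar> \<le> e"
      if *: "\<forall>a'\<in>A. mdist n a a' < \<rho> a / 2 \<longrightarrow> \<bar>?c a' (Suc k) - c\<bar> \<le> e" for k c e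
    proof -
      have le: "\<bar>w j a * (?c (b j) (Suc k) - c)\<bar> \<le> w j a * e" for j
      proof (cases "w j a = 0")
        case False
        then have "\<bar>?c (b j) (Suc k) - c\<bar> \<le> e"
          using * bA[of j] contrib[OF a False] \<rho>_pos[OF a] by auto
        then show ?thesis
          using w_nonneg[of j a] by (simp add: abs_mult mult_left_mono)
      qed simp
      have "F k a - S a * c = (\<Sum>j. w j a * (?c (b j) (Suc k) - c))"
        unfolding F_def S_def suminf_mult2[OF w_sum] right_diff_distrib
        by (rule suminf_diff[OF F_sum summable_mult2[OF w_sum]])
      also have "\<bar>\<dots>\<bar> \<le> (\<Sum>j. w j a * e)"
        by (rule norm_suminf_le[where 'a = real, unfolded real_norm_def, OF le summable_mult2[OF w_sum]])
      also have "\<dots> = S a * e"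
        unfolding S_def by (rule suminf_mult2[OF w_sum, symmetric])
      finally have "\<bar>F k a - S a * c\<bar> \<le> S a * e" .
      moreover have "F k a / S a - c = (F k a - S a * c) / S a"
        using S_pos[OF a] by (simp add: field_simps)
      ultimately show ?thesis
        using S_pos[OF a] by (simp add: abs_divide field_simps)
    qed
    \<comment> \<open>The radius \<open>\<rho> a / 2\<close> lies strictly between
      \<open>\<rho> a / 3\<close>, which bounds the height and the distances of contributing
      centres, and \<open>\<rho> a\<close>, below which every radius is good.\<close>
    then have "between a (\<rho> a / 2) (z a)"
      using S_pos[OF a] S_le \<rho>_pos[OF a] by (auto simp: between_def z_def)
    moreover have "good a (\<rho> a / 2)"
      using \<rho>_good[OF a] \<rho>_pos[OF a] by simp
    ultimately show ?thesis
      using a An \<rho>_pos[OF a] unfolding good_def by auto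
  qed
  define V'' where "V'' = {y \<in> topspace (subtopology Y V'). z y \<in> W}"
  have V'': "openin Y V''"
    unfolding V''_def using openin_continuous_map_preimage[OF cz, of W] W V'
    by (metis open_openin openin_trans_full)
  have "continuous_map (subtopology Y V'') euclidean z"
    by (rule continuous_map_from_subtopology_mono[OF cz]) (auto simp: V''_def)
  then have "continuous_map (subtopology Y V'') (top_of_set (collar m q \<inter> W)) z"
    by (auto simp: continuous_map_in_subtopology V''_def V'_def collar_def z_def)
  then have crz: "continuous_map (subtopology Y V'') X (r \<circ> z)"
    using r by (rule continuous_map_compose)
  define V where "V = {y \<in> topspace (subtopology Y V''). (y, r (z y)) \<in> R}"
  have "continuous_map (subtopology Y V'') (prod_topology Y X) (\<lambda>y. (y, r (z y)))"
    by (rule continuous_map_pairedI[OF continuous_map_from_subtopology[OF continuous_map_id[unfolded id_def]]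
          crz[unfolded o_def]])
  from openin_continuous_map_preimage[OF this R] have "openin (subtopology Y V'') V"
    by (simp add: V_def)
  then have V: "openin Y V"
    using V'' openin_trans_full by blast
  show thesis
  proof (rule that[of V "r \<circ> z"])
    show "openin Y V" by fact
    show "A \<subseteq> V"
      using zQ S_pos A by (auto simp: V_def V''_def V'_def Q_def)
    show "continuous_map (subtopology Y V) X (r \<circ> z)"
      by (rule continuous_map_from_subtopology_mono[OF crz]) (auto simp: V_def)
    show "(y, (r \<circ> z) y) \<in> R" if "y \<in> V" for y
      using that by (auto simp: V_def)
  qed
qed

section \<open>Vertical homotopies\<close>

text \<open>The domain and the end maps \<open>f\<close>, \<open>g\<close> are left general: the
  corrections at the ends and the detour near the diagonal join maps other than the two
  projections.\<close>

definition vertical_homotopy ::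
    "'a topology \<Rightarrow> ('a \<Rightarrow> 'b) \<Rightarrow> 'c topology \<Rightarrow> ('c \<Rightarrow> 'a) \<Rightarrow> ('c \<Rightarrow> 'a) \<Rightarrow> ('c \<times> real \<Rightarrow> 'a) \<Rightarrow> bool" where
  "vertical_homotopy E p Y f g h \<longleftrightarrow> continuous_map (prod_topology Y unit_interval) E h \<and>
     (\<forall>y\<in>topspace Y. h (y, 0) = f y \<and> h (y, 1) = g y \<and> (\<forall>t\<in>{0..1}. p (h (y, t)) = p (f y)))"

lemma continuous_map_unit_interval:
  "continuous_map X unit_interval f \<longleftrightarrow>
     continuous_map X euclideanreal f \<and> (\<forall>x\<in>topspace X. 0 \<le> f x \<and> f x \<le> 1)"
  by (auto simp: continuous_map_in_subtopology Pi_iff)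

lemma continuous_map_homotopy_compose:
  assumes h: "continuous_map (prod_topology Y unit_interval) X h"
    and a: "continuous_map Z Y a" and b: "continuous_map Z unit_interval b"
  shows "continuous_map Z X (\<lambda>z. h (a z, b z))"
  using continuous_map_compose[OF continuous_map_pairedI[OF a b] h] by (simp add: o_def)

lemma continuous_map_parameter:
  "continuous_map (prod_topology Y unit_interval) Y fst"
  "continuous_map (prod_topology Y unit_interval) unit_interval snd"
  "continuous_map (prod_topology Y unit_interval) euclideanreal snd"
  using continuous_map_fst[of Y unit_interval] continuous_map_snd[of Y unit_interval]
  by (auto simp: continuous_map_unit_interval)

text \<open>The segment of \<open>h\<close> between the times \<open>a z\<close> and
  \<open>b z\<close> is traversed linearly. The case \<open>a z > b z\<close> is allowed and runs
  \<open>h\<close> backwards.\<close>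

lemma vertical_homotopy_reparametrize:
  assumes h: "vertical_homotopy E p Y f g h" and \<phi>: "continuous_map Z Y \<phi>"
    and a: "continuous_map Z unit_interval a" and b: "continuous_map Z unit_interval b"
  shows "vertical_homotopy E p Z (\<lambda>z. h (\<phi> z, a z)) (\<lambda>z. h (\<phi> z, b z))
           (\<lambda>(z, t). h (\<phi> z, (1 - t) * a z + t * b z))"
proof -
  have ab: "0 \<le> (1 - t) * a z + t * b z \<and> (1 - t) * a z + t * b z \<le> 1"
    if "z \<in> topspace Z" "0 \<le> t" "t \<le> 1" for z t
    using that a b unfolding continuous_map_unit_interval
    by (auto intro!: convex_bound_le add_nonneg_nonneg mult_nonneg_nonneg)
  let ?P = "prod_topology Z unit_interval"
  have "continuous_map ?P unit_interval (\<lambda>z. (1 - snd z) * a (fst z) + snd z * b (fst z))"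
    using a b ab continuous_map_compose[OF continuous_map_parameter(1)[of Z], of euclideanreal a]
      continuous_map_compose[OF continuous_map_parameter(1)[of Z], of euclideanreal b]
    unfolding continuous_map_unit_interval
    by (auto intro!: continuous_intros continuous_map_parameter simp: o_def)
  moreover have "continuous_map ?P Y (\<lambda>z. \<phi> (fst z))"
    using continuous_map_compose[OF continuous_map_parameter(1) \<phi>] by (simp add: o_def)
  ultimately have "continuous_map ?P E (\<lambda>z. h (\<phi> (fst z), (1 - snd z) * a (fst z) + snd z * b (fst z)))"
    using h unfolding vertical_homotopy_def by (intro continuous_map_homotopy_compose) auto
  moreover have "\<phi> z \<in> topspace Y" if "z \<in> topspace Z" for z
    using \<phi> that by (auto simp: continuous_map_def)
  ultimately show ?thesis
    using h ab a b unfolding vertical_homotopy_def continuous_map_unit_interval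
    by (auto simp: case_prod_unfold)
qed

lemma vertical_homotopy_pullback:
  assumes h: "vertical_homotopy E p Y f g h" and \<phi>: "continuous_map Z Y \<phi>"
  shows "vertical_homotopy E p Z (\<lambda>z. f (\<phi> z)) (\<lambda>z. g (\<phi> z)) (\<lambda>(z, t). h (\<phi> z, t))"
proof -
  have "continuous_map (prod_topology Z unit_interval) E (\<lambda>z. h (\<phi> (fst z), snd z))"
    using h continuous_map_compose[OF continuous_map_parameter(1) \<phi>] unfolding vertical_homotopy_def
    by (intro continuous_map_homotopy_compose continuous_map_parameter) (auto simp: o_def)
  moreover have "\<phi> z \<in> topspace Y" if "z \<in> topspace Z" for z
    using \<phi> that by (auto simp: continuous_map_def)
  ultimately show ?thesis
    using h unfolding vertical_homotopy_def by (auto simp: case_prod_unfold)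
qed

lemma vertical_homotopy_subset:
  assumes "vertical_homotopy E p (subtopology X V) f g h" "W \<subseteq> V"
  shows "vertical_homotopy E p (subtopology X W) f g h"
proof -
  have "continuous_map (subtopology X W) (subtopology X V) (\<lambda>x. x)"
    using assms(2) by (auto simp: continuous_map_in_subtopology)
  from vertical_homotopy_pullback[OF assms(1) this] show ?thesis by simp
qed

lemma vertical_homotopy_cong:
  assumes "vertical_homotopy E p Y f g h" "\<And>y. y \<in> topspace Y \<Longrightarrow> f y = f' y" "\<And>y. y \<in> topspace Y \<Longrightarrow> g y = g' y"
  shows "vertical_homotopy E p Y f' g' h"
  using assms unfolding vertical_homotopy_def by auto

definition homotopy_join :: "('c \<times> real \<Rightarrow> 'a) \<Rightarrow> ('c \<times> real \<Rightarrow> 'a) \<Rightarrow> 'c \<times> real \<Rightarrow> 'a" where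
  "homotopy_join h k = (\<lambda>(y, t). if t \<le> 1/2 then h (y, 2 * t) else k (y, 2 * t - 1))"

lemma vertical_homotopy_join:
  assumes h: "vertical_homotopy E p Y f g h" and k: "vertical_homotopy E p Y g l k"
  shows "vertical_homotopy E p Y f l (homotopy_join h k)"
proof -
  let ?P = "prod_topology Y unit_interval"
  have ch: "continuous_map ?P E h" and ck: "continuous_map ?P E k"
    using h k by (auto simp: vertical_homotopy_def)
  have "continuous_map ?P E (\<lambda>z. if snd z \<le> 1/2 then h (fst z, 2 * snd z) else k (fst z, 2 * snd z - 1))"
  proof (rule continuous_map_cases_le)
    show "continuous_map ?P euclideanreal snd" "continuous_map ?P euclideanreal (\<lambda>z. 1/2)"
      by (auto intro: continuous_map_parameter)
    show "continuous_map (subtopology ?P {z \<in> topspace ?P. snd z \<le> 1/2}) E (\<lambda>z. h (fst z, 2 * snd z))"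
      by (intro continuous_map_homotopy_compose[OF ch])
         (auto simp: continuous_map_unit_interval intro!: continuous_intros continuous_map_from_subtopology continuous_map_parameter)
    show "continuous_map (subtopology ?P {z \<in> topspace ?P. 1/2 \<le> snd z}) E (\<lambda>z. k (fst z, 2 * snd z - 1))"
      by (intro continuous_map_homotopy_compose[OF ck])
         (auto simp: continuous_map_unit_interval intro!: continuous_intros continuous_map_from_subtopology continuous_map_parameter)
    show "h (fst z, 2 * snd z) = k (fst z, 2 * snd z - 1)" if "z \<in> topspace ?P" "snd z = 1/2" for z
    proof -
      have "fst z \<in> topspace Y"
        using that by auto
      moreover have t: "2 * snd z = 1"
        using that(2) by simp
      ultimately show ?thesis
        unfolding t using h k by (simp add: vertical_homotopy_def)
    qed
  qed
  moreover have "p (g y) = p (f y)" if "y \<in> topspace Y" for y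
    using h that unfolding vertical_homotopy_def by (metis atLeastAtMost_iff order_refl zero_le_one)
  ultimately show ?thesis
    using h k unfolding vertical_homotopy_def homotopy_join_def by (auto simp: case_prod_unfold)
qed

text \<open>Disjoint open pieces can be pasted without any compatibility between \<open>h\<close>
  and \<open>k\<close>. This glues the section near the diagonal to one cut off away from
  it.\<close>

lemma vertical_homotopy_Un:
  assumes P: "openin X P" and Q: "openin X Q" and "P \<inter> Q = {}"
    and h: "vertical_homotopy E p (subtopology X P) f g h"
    and k: "vertical_homotopy E p (subtopology X Q) f g k"
  shows "vertical_homotopy E p (subtopology X (P \<union> Q)) f g (\<lambda>(x, t). if x \<in> P then h (x, t) else k (x, t))"
proof -
  let ?X = "prod_topology (subtopology X (P \<union> Q)) unit_interval"
  let ?T = "\<lambda>b. (if b then P else Q) \<times> {0..1::real}"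
  let ?l = "\<lambda>(x, t). if x \<in> P then h (x, t) else k (x, t)"
  have ch: "continuous_map (prod_topology (subtopology X P) unit_interval) E h"
    and ck: "continuous_map (prod_topology (subtopology X Q) unit_interval) E k"
    using h k by (auto simp: vertical_homotopy_def)
  have "continuous_map ?X E ?l"
  proof (rule pasting_lemma[where I = UNIV and T = ?T and f = "\<lambda>b. if b then h else k"])
    fix b :: bool
    have "openin (subtopology X (P \<union> Q)) (if b then P else Q)"
      using P Q by (simp add: openin_open_subtopology openin_Un)
    then show "openin ?X (?T b)"
      by (simp add: openin_prod_Times_iff)
    have "subtopology ?X (?T b) = prod_topology (subtopology X (if b then P else Q)) unit_interval"
      unfolding prod_topology_subtopology(1) subtopology_subtopology
      by (rule arg_cong[where f = "subtopology _"]) (auto split: if_splits)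
    then show "continuous_map (subtopology ?X (?T b)) E (if b then h else k)"
      using ch ck by auto
  next
    show "(if i then h else k) x = (if j then h else k) x" if "x \<in> topspace ?X \<inter> ?T i \<inter> ?T j" for i j x
      using that assms(3) by (cases i; cases j) auto
    show "\<exists>j. j \<in> UNIV \<and> x \<in> ?T j \<and> ?l x = (if j then h else k) x" if "x \<in> topspace ?X" for x
      using that by (intro exI[of _ "fst x \<in> P"]) auto
  qed
  then show ?thesis
    using h k unfolding vertical_homotopy_def by auto
qed

section \<open>The fibre square, and sections as vertical homotopies\<close>

lemma topspace_fibre_square:
  "topspace (fibre_square E p) = {(x, y). x \<in> topspace E \<and> y \<in> topspace E \<and> p x = p y}"
  by (auto simp: fibre_square_def)

lemma diagonal_subset: "diagonal E \<subseteq> topspace (fibre_square E p)"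
  by (auto simp: diagonal_def topspace_fibre_square)

lemma continuous_map_into_fibre_square:
  "continuous_map Z (fibre_square E p) (\<lambda>z. (a z, b z)) \<longleftrightarrow>
     continuous_map Z E a \<and> continuous_map Z E b \<and> (\<forall>z\<in>topspace Z. p (a z) = p (b z))"
  by (auto simp: fibre_square_def continuous_map_in_subtopology continuous_map_paired)

lemma continuous_map_fibre_square_projections:
  "continuous_map (fibre_square E p) E fst" "continuous_map (fibre_square E p) E snd"
  unfolding fibre_square_def
  by (auto intro: continuous_map_from_subtopology continuous_map_fst continuous_map_snd)

lemma metrizable_fibre_square: "metrizable_space E \<Longrightarrow> metrizable_space (fibre_square E p)"
  by (simp add: fibre_square_def metrizable_space_subtopology metrizable_space_prod_topology)

lemma closedin_diagonal:
  assumes "Hausdorff_space E"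
  shows "closedin (fibre_square E p) (diagonal E)"
proof -
  have "closedin (fibre_square E p) {x \<in> topspace (fibre_square E p). fst x = snd x}"
    using assms by (rule closedin_continuous_maps_eq) (rule continuous_map_fibre_square_projections)+
  moreover have "{x \<in> topspace (fibre_square E p). fst x = snd x} = diagonal E"
    by (auto simp: topspace_fibre_square diagonal_def)
  ultimately show ?thesis by simp
qed

text \<open>Evaluation of paths is jointly continuous, which uncurries \<open>s\<close>. The unnamed
  point over which a fibrewise path lies is identified by looking at time 0.\<close>

lemma section_over_imp_vertical_homotopy:
  assumes s: "section_over E p V s" and V: "V \<subseteq> topspace (fibre_square E p)"
  shows "vertical_homotopy E p (subtopology (fibre_square E p) V) fst snd (\<lambda>(x, t). s x t)"
proof -
  let ?X = "subtopology (fibre_square E p) V"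
  have s1: "continuous_map ?X (path_space E) s"
    and s2: "\<And>x. x \<in> topspace ?X \<Longrightarrow> \<exists>b. \<forall>t\<in>{0..1}. p (s x t) = b"
    using s by (auto simp: section_over_def fibrewise_path_space_def continuous_map_in_subtopology Pi_iff)
  have "continuous_map (prod_topology ?X unit_interval) (prod_topology (path_space E) unit_interval)
          (\<lambda>z. (s (fst z), snd z))"
    using continuous_map_compose[OF continuous_map_parameter(1) s1]
    by (intro continuous_map_pairedI continuous_map_parameter) (simp add: o_def)
  from continuous_map_compose[OF this continuous_map_path_eval]
  have "continuous_map (prod_topology ?X unit_interval) E (\<lambda>(x, t). s x t)"
    by (simp add: o_def case_prod_unfold)
  moreover have "s x 0 = fst x \<and> s x 1 = snd x" if "x \<in> V" for x
    using s that unfolding section_over_def endpoints_def by (metis fst_conv snd_conv)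
  moreover have "p (s x t) = p (s x 0)" if "x \<in> topspace ?X" "t \<in> {0..1}" for x t
    using s2[OF that(1)] that(2) by (metis atLeastAtMost_iff order_refl zero_le_one)
  ultimately show ?thesis
    by (auto simp: vertical_homotopy_def)
qed

lemma vertical_homotopy_imp_section_over:
  assumes h: "vertical_homotopy E p (subtopology (fibre_square E p) V) fst snd h"
    and V: "V \<subseteq> topspace (fibre_square E p)"
  shows "section_over E p V (\<lambda>x. restrict (\<lambda>t. h (x, t)) {0..1})"
  unfolding section_over_def
proof
  let ?X = "subtopology (fibre_square E p) V"
  have "continuous_map ?X (path_space E) (\<lambda>x. restrict (\<lambda>t. h (x, t)) {0..1})"
    using h by (intro continuous_map_path_curry) (auto simp: vertical_homotopy_def)
  then show "continuous_map ?X (fibrewise_path_space E p) (\<lambda>x. restrict (\<lambda>t. h (x, t)) {0..1})"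
    using h by (auto simp: fibrewise_path_space_def continuous_map_in_subtopology vertical_homotopy_def)
  show "\<forall>x\<in>V. endpoints (restrict (\<lambda>t. h (x, t)) {0..1}) = x"
    using h V by (auto simp: endpoints_def vertical_homotopy_def)
qed

text \<open>Lifting along paths that come to rest at time \<open>\<delta>\<close> and evaluating the lift at that time makes
  the transport regular: it fixes \<open>e\<close> when \<open>b = p e\<close>.\<close>

lemma fibration_local_transport:
  assumes p: "hurewicz_fibration E B p" and B: "metrizable_ANR B" "separable_space B" "topspace B \<noteq> {}"
  obtains M T where "openin (prod_topology B B) M" "\<And>b. b \<in> topspace B \<Longrightarrow> (b, b) \<in> M"
    "continuous_map (subtopology (prod_topology E B) {(e, b). (p e, b) \<in> M}) E T"
    "\<And>e b. e \<in> topspace E \<Longrightarrow> b \<in> topspace B \<Longrightarrow> (p e, b) \<in> M \<Longrightarrow> p (T (e, b)) = b"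
    "\<And>e. e \<in> topspace E \<Longrightarrow> T (e, p e) = e"
proof -
  obtain M \<delta> \<mu> where M: "openin (prod_topology B B) M" "\<And>b. b \<in> topspace B \<Longrightarrow> (b, b) \<in> M"
    and \<delta>: "continuous_map (prod_topology B B) unit_interval \<delta>" "\<And>b. b \<in> topspace B \<Longrightarrow> \<delta> (b, b) = 0"
    and \<mu>: "continuous_map (prod_topology (subtopology (prod_topology B B) M) unit_interval) B \<mu>"
      "\<And>x y. (x, y) \<in> M \<Longrightarrow> \<mu> ((x, y), 0) = x"
      "\<And>x y t. (x, y) \<in> M \<Longrightarrow> \<delta> (x, y) \<le> t \<Longrightarrow> t \<le> 1 \<Longrightarrow> \<mu> ((x, y), t) = y"
    using metrizable_ANR_locally_equiconnected[OF B] by blast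
  have cp: "continuous_map E B p"
    using p by (simp add: hurewicz_fibration_def)
  let ?Y = "subtopology (prod_topology E B) {(e, b). (p e, b) \<in> M}"
  let ?\<phi> = "\<lambda>y. (p (fst y), snd y)"
  have fst_Y: "continuous_map ?Y E fst" and snd_Y: "continuous_map ?Y B snd"
    by (auto intro: continuous_map_from_subtopology continuous_map_fst continuous_map_snd)
  have \<phi>: "continuous_map ?Y (prod_topology B B) ?\<phi>"
    using continuous_map_compose[OF fst_Y cp] snd_Y by (auto simp: continuous_map_paired o_def)
  then have \<phi>M: "continuous_map ?Y (subtopology (prod_topology B B) M) ?\<phi>"
    by (auto simp: continuous_map_in_subtopology)
  have "continuous_map (prod_topology ?Y unit_interval) B (\<lambda>z. \<mu> (?\<phi> (fst z), snd z))"
    using continuous_map_compose[OF continuous_map_parameter(1) \<phi>M]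
    by (intro continuous_map_homotopy_compose[OF \<mu>(1)] continuous_map_parameter) (simp add: o_def)
  moreover have "\<forall>y\<in>topspace ?Y. \<mu> (?\<phi> (fst (y, 0)), snd (y, 0)) = p (fst y)"
    using \<mu>(2) by auto
  \<comment> \<open>A single lifting problem over the space of all admissible pairs makes the lift
    continuous in \<open>e\<close> and \<open>b\<close> together. The points of \<open>?Y\<close>
    have type \<open>'a \<times> 'b\<close>, so the lifting property is used for a type other than
    the one in \<open>hurewicz_fibration\<close>.\<close>
  moreover have "has_HLP ?Y E B p"
    using p by (rule hurewicz_fibration_HLP)
  ultimately obtain G where G: "continuous_map (prod_topology ?Y unit_interval) E G"
      "\<forall>y\<in>topspace ?Y. G (y, 0) = fst y"
      "\<forall>y\<in>topspace ?Y. \<forall>t\<in>{0..1}. p (G (y, t)) = \<mu> (?\<phi> (fst (y, t)), snd (y, t))"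
    using fst_Y unfolding has_HLP_def by blast
  have c\<delta>: "continuous_map ?Y unit_interval (\<lambda>y. \<delta> (?\<phi> y))"
    using continuous_map_compose[OF \<phi> \<delta>(1)] by (simp add: o_def)
  show thesis
  proof (rule that[of M "\<lambda>y. G (y, \<delta> (?\<phi> y))", OF M])
    show "continuous_map ?Y E (\<lambda>y. G (y, \<delta> (?\<phi> y)))"
      using continuous_map_homotopy_compose[OF G(1) continuous_map_id[unfolded id_def] c\<delta>] .
    show "p (G ((e, b), \<delta> (?\<phi> (e, b)))) = b" if "e \<in> topspace E" "b \<in> topspace B" "(p e, b) \<in> M" for e b
    proof -
      have eb: "(e, b) \<in> topspace ?Y"
        using that by simp
      then have \<delta>01: "0 \<le> \<delta> (p e, b)" "\<delta> (p e, b) \<le> 1"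
        using bspec[OF conjunct2[OF c\<delta>[unfolded continuous_map_unit_interval]] eb] by simp_all
      then have "p (G ((e, b), \<delta> (p e, b))) = \<mu> ((p e, b), \<delta> (p e, b))"
        using bspec[OF bspec[OF G(3) eb], of "\<delta> (p e, b)"] by simp
      then show ?thesis
        using \<mu>(3)[OF that(3) order_refl \<delta>01(2)] by simp
    qed
    show "G ((e, p e), \<delta> (?\<phi> (e, p e))) = e" if "e \<in> topspace E" for e
    proof -
      have "p e \<in> topspace B"
        using cp that by (auto simp: continuous_map_def)
      then show ?thesis
        using that \<delta>(2)[of "p e"] M(2)[of "p e"] bspec[OF G(2), of "(e, p e)"] by simp
    qed
  qed
qed

section \<open>Local sections and extension to open sets\<close>

text \<open>The short path \<open>\<mu>\<close> in \<open>E\<close> from \<open>e\<close> to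
  \<open>e'\<close> leaves the fibre, and \<open>T\<close> moves each of its points back over
  \<open>p e\<close>. Regularity of \<open>T\<close> preserves both endpoints, as
  \<open>p e' = p e\<close>, and keeps the paths over the diagonal constant. \<open>N\<close>
  collects the pairs whose whole path projects close enough to \<open>p e\<close>.\<close>

lemma fibrewise_locally_equiconnected:
  assumes p: "hurewicz_fibration E B p"
    and E: "metrizable_ANR E" "separable_space E" "topspace E \<noteq> {}"
    and B: "metrizable_ANR B" "separable_space B"
  obtains N \<sigma> where "openin (fibre_square E p) N" "diagonal E \<subseteq> N"
    "vertical_homotopy E p (subtopology (fibre_square E p) N) fst snd \<sigma>"
    "\<forall>e\<in>topspace E. \<forall>t\<in>{0..1}. \<sigma> ((e, e), t) = e"
proof -
  have cp: "continuous_map E B p"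
    using p by (simp add: hurewicz_fibration_def)
  then have pB: "p e \<in> topspace B" if "e \<in> topspace E" for e
    using that by (auto simp: continuous_map_def)
  then have "topspace B \<noteq> {}"
    using E(3) by blast
  with fibration_local_transport[OF p B]
  obtain M T where M: "openin (prod_topology B B) M" "\<And>b. b \<in> topspace B \<Longrightarrow> (b, b) \<in> M"
    and T: "continuous_map (subtopology (prod_topology E B) {(e, b). (p e, b) \<in> M}) E T"
      "\<And>e b. e \<in> topspace E \<Longrightarrow> b \<in> topspace B \<Longrightarrow> (p e, b) \<in> M \<Longrightarrow> p (T (e, b)) = b"
      "\<And>e. e \<in> topspace E \<Longrightarrow> T (e, p e) = e"
    by blast
  obtain L \<delta> \<mu> where L: "openin (prod_topology E E) L" "\<And>e. e \<in> topspace E \<Longrightarrow> (e, e) \<in> L"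
    and \<delta>: "continuous_map (prod_topology E E) unit_interval \<delta>" "\<And>e. e \<in> topspace E \<Longrightarrow> \<delta> (e, e) = 0"
    and \<mu>: "continuous_map (prod_topology (subtopology (prod_topology E E) L) unit_interval) E \<mu>"
      "\<And>x y. (x, y) \<in> L \<Longrightarrow> \<mu> ((x, y), 0) = x"
      "\<And>x y t. (x, y) \<in> L \<Longrightarrow> \<delta> (x, y) \<le> t \<Longrightarrow> t \<le> 1 \<Longrightarrow> \<mu> ((x, y), t) = y"
    using metrizable_ANR_locally_equiconnected[OF E] by blast
  let ?X = "fibre_square E p"
  let ?XL = "subtopology ?X L"
  have XL: "openin ?X (topspace ?X \<inter> L)"
    using L(1) by (auto simp: fibre_square_def openin_subtopology)
  have "subtopology (subtopology (prod_topology E E) L) {(e1, e2). p e1 = p e2} = ?XL"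
    by (simp add: fibre_square_def subtopology_subtopology Int_commute)
  then have c\<mu>: "continuous_map (prod_topology ?XL unit_interval) E \<mu>"
    using continuous_map_prod_subtopology[OF \<mu>(1)] by metis
  have "continuous_map ?XL B (\<lambda>x. p (fst x))"
    using continuous_map_compose[OF continuous_map_fibre_square_projections(1) cp, of p]
    by (simp add: continuous_map_from_subtopology o_def)
  then have cpf: "continuous_map (prod_topology ?XL unit_interval) B (\<lambda>z. p (fst (fst z)))"
    using continuous_map_compose[OF continuous_map_parameter(1)] by (force simp: o_def)
  have cpair: "continuous_map (prod_topology ?XL unit_interval) (prod_topology B B) (\<lambda>z. (p (\<mu> z), p (fst (fst z))))"
    using continuous_map_compose[OF c\<mu> cp] cpf by (intro continuous_map_pairedI) (simp_all add: o_def)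
  define N where "N = {x \<in> topspace ?XL. \<forall>t\<in>{0..1}. (p (\<mu> (x, t)), p (fst x)) \<in> M}"
  have N_sub: "N \<subseteq> topspace ?X \<inter> L"
    by (auto simp: N_def)
  let ?\<sigma> = "\<lambda>(x, t). T (\<mu> (x, t), p (fst x))"
  show thesis
  proof (rule that[of N ?\<sigma>])
    have "openin ?XL N"
      unfolding N_def using tube_open[OF cpair M(1)] by simp
    then have "openin (subtopology ?X (topspace ?X \<inter> L)) N"
      by (simp only: subtopology_restrict)
    then show N: "openin ?X N"
      using XL openin_trans_full by blast
    have \<mu>_diag: "\<mu> ((e, e), t) = e" if "e \<in> topspace E" "t \<in> {0..1}" for e t
      using that \<mu>(3)[of e e t] \<delta>(2) L(2) by auto
    then show "diagonal E \<subseteq> N"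
      using L(2) M(2) pB by (auto simp: diagonal_def N_def topspace_fibre_square)
    show "\<forall>e\<in>topspace E. \<forall>t\<in>{0..1}. ?\<sigma> ((e, e), t) = e"
      using T(3) \<mu>_diag by simp
    let ?XN = "subtopology ?X N"
    have sub: "subtopology ?XL N = ?XN"
      using N_sub by (simp add: subtopology_subtopology Int_absorb1 le_infI2)
    have c\<mu>N: "continuous_map (prod_topology ?XN unit_interval) E \<mu>"
      and cpN: "continuous_map (prod_topology ?XN unit_interval) B (\<lambda>z. p (fst (fst z)))"
      using continuous_map_prod_subtopology[OF c\<mu>, of N] continuous_map_prod_subtopology[OF cpf, of N]
      unfolding sub by auto
    have "continuous_map (prod_topology ?XN unit_interval)
        (subtopology (prod_topology E B) {(e, b). (p e, b) \<in> M}) (\<lambda>z. (\<mu> z, p (fst (fst z))))"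
      using c\<mu>N cpN by (auto simp: continuous_map_in_subtopology continuous_map_paired N_def)
    from continuous_map_compose[OF this T(1)]
    have "continuous_map (prod_topology ?XN unit_interval) E ?\<sigma>"
      by (simp add: o_def case_prod_unfold)
    moreover have "?\<sigma> (x, 0) = fst x \<and> ?\<sigma> (x, 1) = snd x \<and> (\<forall>t\<in>{0..1}. p (?\<sigma> (x, t)) = p (fst x))"
      if x: "x \<in> N" for x
    proof -
      obtain e e' where e: "x = (e, e')" "e \<in> topspace E" "e' \<in> topspace E" "p e = p e'" "(e, e') \<in> L"
        using x N_sub by (cases x) (auto simp: topspace_fibre_square)
      have \<delta>1: "\<delta> (e, e') \<le> 1"
        using \<delta>(1) e by (auto simp: continuous_map_unit_interval)
      have "p (T (\<mu> (x, t), p e)) = p e" if t: "t \<in> {0..1}" for t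
      proof (rule T(2))
        show "\<mu> (x, t) \<in> topspace E"
          using c\<mu>N x t N_sub by (auto simp: continuous_map_def Pi_iff)
        show "(p (\<mu> (x, t)), p e) \<in> M"
          using x t e by (auto simp: N_def)
      qed (use pB e in auto)
      moreover have "T (e', p e) = e'"
        using T(3)[of e'] e by simp
      ultimately show ?thesis
        using e \<mu>(2)[of e e'] \<mu>(3)[of e e' 1] \<delta>1 T(3)[of e] by auto
    qed
    ultimately show "vertical_homotopy E p ?XN fst snd ?\<sigma>"
      unfolding vertical_homotopy_def by auto
  qed
qed

text \<open>\<open>R\<close> admits a value over \<open>(x, t)\<close> if it can be transported into
  the fibre of \<open>x\<close> and, for \<open>t = 0\<close> or \<open>t = 1\<close>, if the
  transported value is close to the corresponding endpoint. Each value of \<open>h\<close> is fixed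
  by the transport and hits the endpoints exactly, so \<open>h\<close> satisfies
  \<open>R\<close>.\<close>

lemma section_extends_to_open:
  assumes p: "hurewicz_fibration E B p"
    and E: "metrizable_ANR E" "separable_space E"
    and B: "metrizable_ANR B" "separable_space B"
    and U: "U \<subseteq> topspace (fibre_square E p)"
    and h: "vertical_homotopy E p (subtopology (fibre_square E p) U) fst snd h"
  obtains V g where "openin (fibre_square E p) V" "U \<subseteq> V"
    "vertical_homotopy E p (subtopology (fibre_square E p) V) fst snd g"
proof (cases "topspace E = {}")
  case True
  then have "U = topspace (fibre_square E p)"
    using U by (auto simp: topspace_fibre_square)
  with h show thesis
    by (intro that[of U h]) auto
next
  case False
  have cp: "continuous_map E B p"
    using p by (simp add: hurewicz_fibration_def)
  then have pB: "p e \<in> topspace B" if "e \<in> topspace E" for e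
    using that by (auto simp: continuous_map_def)
  then have "topspace B \<noteq> {}"
    using False by blast
  with fibration_local_transport[OF p B]
  obtain M T where M: "openin (prod_topology B B) M" "\<And>b. b \<in> topspace B \<Longrightarrow> (b, b) \<in> M"
    and T: "continuous_map (subtopology (prod_topology E B) {(e, b). (p e, b) \<in> M}) E T"
      "\<And>e b. e \<in> topspace E \<Longrightarrow> b \<in> topspace B \<Longrightarrow> (p e, b) \<in> M \<Longrightarrow> p (T (e, b)) = b"
      "\<And>e. e \<in> topspace E \<Longrightarrow> T (e, p e) = e"
    by blast
  obtain N \<sigma> where N: "openin (fibre_square E p) N" "diagonal E \<subseteq> N"
    and \<sigma>: "vertical_homotopy E p (subtopology (fibre_square E p) N) fst snd \<sigma>"
    by (rule fibrewise_locally_equiconnected[OF p E False B])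
  let ?X = "fibre_square E p"
  let ?Y = "prod_topology ?X unit_interval"
  let ?A = "U \<times> {0..1::real}"
  let ?Z = "prod_topology ?Y E"
  let ?D = "subtopology (prod_topology E B) {(e, b). (p e, b) \<in> M}"
  have metE: "metrizable_space E"
    using E(1) by (simp add: metrizable_ANR_def)
  have metY: "metrizable_space ?Y"
    by (simp add: metrizable_space_prod_topology metrizable_fibre_square metE
        metrizable_space_subtopology metrizable_space_euclidean)
  \<comment> \<open>Separability need not pass to the arbitrary subset \<open>?A\<close>, but second
    countability does.\<close>
  have "second_countable ?Y"
    unfolding fibre_square_def using separable_imp_second_countable[OF metE E(2)]
    by (intro second_countable_prod_topology second_countable_subtopology second_countable_euclidean)
  then have sepA: "separable_space (subtopology ?Y ?A)"
    by (intro second_countable_imp_separable_space second_countable_subtopology)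
  have subA: "subtopology ?Y ?A = prod_topology (subtopology ?X U) unit_interval"
    unfolding prod_topology_subtopology(1) by simp
  have A: "?A \<subseteq> topspace ?Y"
    using U by auto
  have ch: "continuous_map (subtopology ?Y ?A) E h"
    using h unfolding subA by (simp add: vertical_homotopy_def)
  have Z: "continuous_map ?Z E snd" "continuous_map ?Z ?X (\<lambda>z. fst (fst z))"
      "continuous_map ?Z euclideanreal (\<lambda>z. snd (fst z))"
    using continuous_map_fst_apply[OF continuous_map_fst[of ?Y E]]
      continuous_map_snd_apply[OF continuous_map_fst[of ?Y E]]
    by (auto simp: continuous_map_snd continuous_map_unit_interval)
  have Z': "continuous_map ?Z E (\<lambda>z. fst (fst (fst z)))" "continuous_map ?Z E (\<lambda>z. snd (fst (fst z)))"
    using continuous_map_compose[OF Z(2) continuous_map_fibre_square_projections(1)]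
      continuous_map_compose[OF Z(2) continuous_map_fibre_square_projections(2)] by (auto simp: o_def)
  have cpZ: "continuous_map ?Z B (\<lambda>z. p (snd z))" "continuous_map ?Z B (\<lambda>z. p (fst (fst (fst z))))"
    using continuous_map_compose[OF Z(1) cp] continuous_map_compose[OF Z'(1) cp] by (auto simp: o_def)
  define R0 where "R0 = {z \<in> topspace ?Z. (p (snd z), p (fst (fst (fst z)))) \<in> M}"
  have R0: "openin ?Z R0"
    unfolding R0_def by (rule openin_continuous_map_preimage[OF _ M(1)]) (intro continuous_map_pairedI cpZ)
  let ?ZR = "subtopology ?Z R0"
  let ?T = "\<lambda>z. T (snd z, p (fst (fst (fst z))))"
  have "continuous_map ?ZR ?D (\<lambda>z. (snd z, p (fst (fst (fst z)))))"
    using Z(1) cpZ(2) by (auto simp: continuous_map_in_subtopology continuous_map_paired R0_def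
        intro: continuous_map_from_subtopology)
  from continuous_map_compose[OF this T(1)] have cT: "continuous_map ?ZR E ?T"
    by (simp add: o_def)
  have pT: "p (?T z) = p (fst (fst (fst z)))" if "z \<in> R0" for z
    using that pB by (intro T(2)) (auto simp: R0_def topspace_fibre_square)
  have "continuous_map ?ZR ?X (\<lambda>z. (fst (fst (fst z)), ?T z))"
       "continuous_map ?ZR ?X (\<lambda>z. (?T z, snd (fst (fst z))))"
    using cT pT continuous_map_from_subtopology[OF Z'(1)] continuous_map_from_subtopology[OF Z'(2)]
    by (auto simp: continuous_map_into_fibre_square R0_def topspace_fibre_square)
  then have "openin ?ZR {z \<in> topspace ?ZR. (fst (fst (fst z)), ?T z) \<in> N}"
      "openin ?ZR {z \<in> topspace ?ZR. (?T z, snd (fst (fst z))) \<in> N}"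
    using openin_continuous_map_preimage[OF _ N(1)] by fast+
  then have R12: "openin ?Z {z \<in> topspace ?ZR. (fst (fst (fst z)), ?T z) \<in> N}"
      "openin ?Z {z \<in> topspace ?ZR. (?T z, snd (fst (fst z))) \<in> N}"
    using openin_trans_full[OF _ R0] by blast+
  have ne: "openin ?Z {z \<in> topspace ?Z. snd (fst z) \<in> - {c}}" for c
    by (rule openin_continuous_map_preimage[OF Z(3)]) auto
  \<comment> \<open>The endpoint conditions are implications from \<open>t = 0\<close> and from
    \<open>t = 1\<close>. Written as unions with the open sets where \<open>t\<close> differs from 0
    or 1, they remain open.\<close>
  define R where "R = R0
    \<inter> ({z \<in> topspace ?ZR. (fst (fst (fst z)), ?T z) \<in> N} \<union> {z \<in> topspace ?Z. snd (fst z) \<in> - {0}})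
    \<inter> ({z \<in> topspace ?ZR. (?T z, snd (fst (fst z))) \<in> N} \<union> {z \<in> topspace ?Z. snd (fst z) \<in> - {1}})"
  have R: "openin ?Z R"
    unfolding R_def by (intro openin_Int openin_Un R0 R12 ne)
  have "(a, h a) \<in> R" if "a \<in> ?A" for a
  proof -
    obtain e e' t where a: "a = ((e, e'), t)" "(e, e') \<in> U" "t \<in> {0..1}"
      using \<open>a \<in> ?A\<close> by auto
    have e: "e \<in> topspace E" "e' \<in> topspace E" "p e = p e'"
      using a(2) U by (auto simp: topspace_fibre_square)
    have ha: "h a \<in> topspace E"
      using ch that A by (auto simp: continuous_map_def Pi_iff)
    have hx: "h ((e, e'), 0) = e" "h ((e, e'), 1) = e'" "p (h a) = p e"
      using h a U by (auto simp: vertical_homotopy_def)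
    have zR0: "(a, h a) \<in> R0"
      using ha hx(3) a U pB[OF e(1)] M(2) by (auto simp: R0_def)
    have "T (h a, p e) = h a"
      using T(3)[OF ha] hx(3) by simp
    moreover have "(e, e) \<in> N" "(e', e') \<in> N"
      using N(2) e by (auto simp: diagonal_def)
    ultimately show ?thesis
      using zR0 hx(1,2) openin_subset[OF R0] a by (auto simp: R_def)
  qed
  then obtain V' g where V': "openin ?Y V'" "?A \<subseteq> V'"
    and g: "continuous_map (subtopology ?Y V') E g" "\<And>y. y \<in> V' \<Longrightarrow> (y, g y) \<in> R"
    using metrizable_ANR_approximate_extension[OF E metY sepA A ch R] by blast
  \<comment> \<open>The approximation lives on a neighbourhood of \<open>U \<times> {0..1}\<close>;
    the tube lemma extracts a product neighbourhood \<open>V \<times> {0..1}\<close> from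
    it.\<close>
  define V where "V = {x \<in> topspace ?X. \<forall>t\<in>{0..1}. (x, t) \<in> V'}"
  have V: "openin ?X V"
    unfolding V_def using V'(1) by (intro tube_open[where F = "\<lambda>z. z"]) auto
  have VX: "V \<subseteq> topspace ?X"
    by (auto simp: V_def)
  have UV: "U \<subseteq> V"
    using U V'(2) by (auto simp: V_def)
  let ?XV = "subtopology ?X V"
  let ?P = "prod_topology ?XV unit_interval"
  have subP: "?P = subtopology ?Y (V \<times> {0..1})"
    unfolding prod_topology_subtopology(1) by simp
  have cg: "continuous_map ?P E g"
    unfolding subP by (rule continuous_map_from_subtopology_mono[OF g(1)]) (auto simp: V_def)
  define k where "k = (\<lambda>(x, t). T (g (x, t), p (fst x)))"
  have gR: "((x, t), g (x, t)) \<in> R" if "x \<in> V" "t \<in> {0..1}" for x t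
    using that g(2) by (auto simp: V_def)
  then have gR0: "((x, t), g (x, t)) \<in> R0" if "x \<in> V" "t \<in> {0..1}" for x t
    using that by (auto simp: R_def)
  have "continuous_map ?P ?ZR (\<lambda>z. (z, g z))"
    unfolding continuous_map_in_subtopology
  proof
    have "continuous_map ?P ?Y (\<lambda>z. z)"
      unfolding subP by (rule continuous_map_from_subtopology) simp
    then show "continuous_map ?P ?Z (\<lambda>z. (z, g z))"
      using cg by (rule continuous_map_pairedI)
    show "(\<lambda>z. (z, g z)) \<in> topspace ?P \<rightarrow> R0"
      using gR0 by auto
  qed
  from continuous_map_compose[OF this cT] have ck: "continuous_map ?P E k"
    by (simp add: o_def k_def case_prod_unfold)
  have pk: "p (k (x, t)) = p (fst x)" if "x \<in> V" "t \<in> {0..1}" for x t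
    using pT[OF gR0[OF that]] by (simp add: k_def)
  have vk: "vertical_homotopy E p ?XV (\<lambda>x. k (x, 0)) (\<lambda>x. k (x, 1)) k"
    using ck pk by (auto simp: vertical_homotopy_def)
  have cproj: "continuous_map ?XV E fst" "continuous_map ?XV E snd"
    by (auto intro: continuous_map_from_subtopology continuous_map_fibre_square_projections)
  have ck01: "continuous_map ?XV E (\<lambda>x. k (x, c))" if "c \<in> {0..1}" for c
    using that by (intro continuous_map_homotopy_compose[OF ck]) (auto simp: continuous_map_unit_interval)
  have N0: "(fst x, k (x, 0)) \<in> N" and N1: "(k (x, 1), snd x) \<in> N" if "x \<in> V" for x
    using gR[OF that, of 0] gR[OF that, of 1] by (auto simp: R_def k_def)
  have ends: "continuous_map ?XV (subtopology ?X N) (\<lambda>x. (fst x, k (x, 0)))"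
      "continuous_map ?XV (subtopology ?X N) (\<lambda>x. (k (x, 1), snd x))"
    using cproj ck01 pk N0 N1 VX
    by (auto simp: continuous_map_in_subtopology continuous_map_into_fibre_square topspace_fibre_square)
  \<comment> \<open>The homotopy \<open>k\<close> is vertical but starts and ends only near the
    right points; \<open>\<sigma>\<close> supplies the two missing end pieces.\<close>
  have "vertical_homotopy E p ?XV fst (\<lambda>x. k (x, 0)) (\<lambda>(x, t). \<sigma> ((fst x, k (x, 0)), t))"
       "vertical_homotopy E p ?XV (\<lambda>x. k (x, 1)) snd (\<lambda>(x, t). \<sigma> ((k (x, 1), snd x), t))"
    using vertical_homotopy_pullback[OF \<sigma> ends(1)] vertical_homotopy_pullback[OF \<sigma> ends(2)] by simp_all
  then show thesis
    using vk by (intro that[OF V UV]) (blast intro: vertical_homotopy_join)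
qed

section \<open>Normalization along the diagonal\<close>

text \<open>Over \<open>(e, e')\<close> the new path runs back along \<open>h (e, e)\<close> for a while, crosses to \<open>h (e, e')\<close>
  by \<open>\<sigma>\<close>, and returns along it; the excursion shrinks to nothing as \<open>(e, e')\<close> approaches the
  diagonal.\<close>

lemma section_normalize_on_diagonal:
  assumes E: "metrizable_space E"
    and N: "openin (fibre_square E p) N" "diagonal E \<subseteq> N"
    and \<sigma>: "vertical_homotopy E p (subtopology (fibre_square E p) N) fst snd \<sigma>"
      "\<forall>e\<in>topspace E. \<forall>t\<in>{0..1}. \<sigma> ((e, e), t) = e"
    and V: "openin (fibre_square E p) V" "diagonal E \<subseteq> V"
    and h: "vertical_homotopy E p (subtopology (fibre_square E p) V) fst snd h"
  obtains g where "vertical_homotopy E p (subtopology (fibre_square E p) V) fst snd g"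
    "\<forall>e\<in>topspace E. \<forall>t\<in>{0..1}. g ((e, e), t) = e"
proof -
  let ?X = "fibre_square E p"
  let ?XV = "subtopology ?X V"
  have VX: "V \<subseteq> topspace ?X"
    using V(1) by (rule openin_subset)
  have tV: "topspace ?XV = V"
    using VX by auto
  have ch: "continuous_map (prod_topology ?XV unit_interval) E h"
    using h by (simp add: vertical_homotopy_def)
  have h0: "h (x, 0) = fst x" "h (x, 1) = snd x" if "x \<in> V" for x
    using h that VX by (auto simp: vertical_homotopy_def)
  have hp: "p (h (x, t)) = p (fst x)" if "x \<in> V" "t \<in> {0..1}" for x t
    using h that VX by (auto simp: vertical_homotopy_def)
  define d :: "'a \<times> 'a \<Rightarrow> 'a \<times> 'a" where "d = (\<lambda>x. (fst x, fst x))"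
  have d_diag: "d x \<in> diagonal E" if "x \<in> V" for x
    using subsetD[OF VX that] by (auto simp: topspace_fibre_square d_def diagonal_def)
  then have dV: "d x \<in> V" if "x \<in> V" for x
    using V(2) that by blast
  have cproj: "continuous_map ?XV E fst"
    by (intro continuous_map_from_subtopology continuous_map_fibre_square_projections)
  then have cd: "continuous_map ?XV ?XV d"
    using dV VX by (auto simp: continuous_map_in_subtopology continuous_map_into_fibre_square d_def)
  have cid: "continuous_map ?XV ?XV (\<lambda>x. x)"
    by simp
  let ?P = "prod_topology ?XV unit_interval"
  have "continuous_map ?P E (\<lambda>z. h (d (fst z), snd z))" "continuous_map ?P E (\<lambda>z. h (fst z, snd z))"
    using continuous_map_compose[OF continuous_map_parameter(1) cd]
    by (intro continuous_map_homotopy_compose[OF ch] continuous_map_parameter; simp add: o_def)+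
  then have cF: "continuous_map ?P ?X (\<lambda>z. (h (d (fst z), snd z), h (fst z, snd z)))"
    using hp dV VX by (auto simp: continuous_map_into_fibre_square d_def)
  define S where "S = {x \<in> topspace ?XV. \<forall>t\<in>{0..1}. (h (d x, t), h (x, t)) \<in> N}"
  have S: "openin ?XV S"
    unfolding S_def using tube_open[OF cF N(1)] by simp
  have diag_S: "diagonal E \<subseteq> S"
  proof
    fix x assume x: "x \<in> diagonal E"
    then have "d x = x" "x \<in> V"
      using V(2) by (auto simp: d_def diagonal_def)
    moreover have "h (x, t) \<in> topspace E" if "t \<in> {0..1}" for t
      using ch \<open>x \<in> V\<close> that VX by (auto simp: continuous_map_def Pi_iff)
    ultimately show "x \<in> S"
      using N(2) VX by (auto simp: S_def diagonal_def)
  qed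
  have "closedin ?XV (diagonal E)"
    using closedin_diagonal[OF metrizable_imp_Hausdorff_space[OF E]] V(2)
    by (metis closedin_subtopology inf.absorb_iff1)
  moreover have "normal_space ?XV"
    by (intro metrizable_imp_normal_space metrizable_space_subtopology metrizable_fibre_square E)
  moreover have "closedin ?XV (topspace ?XV - S)"
    using S by blast
  moreover have "disjnt (diagonal E) (topspace ?XV - S)"
    using diag_S by (auto simp: disjnt_iff)
  ultimately obtain u where u: "continuous_map ?XV (top_of_set {0..1::real}) u"
      "u ` diagonal E \<subseteq> {0}" "u ` (topspace ?XV - S) \<subseteq> {1}"
    using Urysohn_lemma[of ?XV "diagonal E" "topspace ?XV - S" 0 1] by auto
  \<comment> \<open>\<open>w\<close> is the time of crossing. On the diagonal it is 1, so both outer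
    legs degenerate. Outside \<open>S\<close>, where crossing at an arbitrary time may be
    impossible, it is 0, and there both paths are still at \<open>fst x\<close>.\<close>
  define w where "w = (\<lambda>x. 1 - u x)"
  have w: "continuous_map ?XV unit_interval w"
    using u(1) by (auto simp: continuous_map_unit_interval w_def intro!: continuous_intros)
  have w01: "w x \<in> {0..1}" if "x \<in> V" for x
    using w that VX by (auto simp: continuous_map_unit_interval)
  define c where "c = (\<lambda>x. (h (d x, w x), h (x, w x)))"
  have "c x \<in> N" if x: "x \<in> V" for x
  proof (cases "x \<in> S")
    case True
    then show ?thesis
      using w01[OF x] by (simp add: S_def c_def)
  next
    case False
    then have "w x = 0"
      using u(3) x VX by (auto simp: w_def)
    then have "c x = d x"
      using h0(1)[OF x] h0(1)[OF dV[OF x]] by (simp add: c_def d_def)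
    then show ?thesis
      using d_diag[OF x] N(2) by auto
  qed
  then have cc: "continuous_map ?XV (subtopology ?X N) c"
    using continuous_map_homotopy_compose[OF ch cd w] continuous_map_homotopy_compose[OF ch cid w]
      hp dV w01 VX
    unfolding c_def by (auto simp: continuous_map_in_subtopology continuous_map_into_fibre_square d_def)
  have one: "continuous_map ?XV unit_interval (\<lambda>x. 1)"
    by simp
  have "vertical_homotopy E p ?XV (\<lambda>x. h (d x, 1)) (\<lambda>x. h (d x, w x)) (\<lambda>(x, t). h (d x, (1 - t) * 1 + t * w x))"
    (is "vertical_homotopy _ _ _ _ _ ?h1")
    by (rule vertical_homotopy_reparametrize[OF h cd one w])
  then have h1: "vertical_homotopy E p ?XV fst (\<lambda>x. h (d x, w x)) ?h1"
    by (rule vertical_homotopy_cong) (use h0(2)[OF dV] tV in \<open>simp_all add: d_def\<close>)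
  have h2: "vertical_homotopy E p ?XV (\<lambda>x. h (d x, w x)) (\<lambda>x. h (x, w x)) (\<lambda>(x, t). \<sigma> (c x, t))"
    (is "vertical_homotopy _ _ _ _ _ ?h2")
    using vertical_homotopy_pullback[OF \<sigma>(1) cc] by (simp add: c_def)
  have "vertical_homotopy E p ?XV (\<lambda>x. h (x, w x)) (\<lambda>x. h (x, 1)) (\<lambda>(x, t). h (x, (1 - t) * w x + t * 1))"
    (is "vertical_homotopy _ _ _ _ _ ?h3")
    by (rule vertical_homotopy_reparametrize[OF h cid w one])
  then have h3: "vertical_homotopy E p ?XV (\<lambda>x. h (x, w x)) snd ?h3"
    by (rule vertical_homotopy_cong) (use h0(2) tV in simp_all)
  show thesis
  proof (rule that[of "homotopy_join ?h1 (homotopy_join ?h2 ?h3)"])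
    show "vertical_homotopy E p ?XV fst snd (homotopy_join ?h1 (homotopy_join ?h2 ?h3))"
      by (intro vertical_homotopy_join[OF h1] vertical_homotopy_join[OF h2 h3])
    show "\<forall>e\<in>topspace E. \<forall>t\<in>{0..1}. homotopy_join ?h1 (homotopy_join ?h2 ?h3) ((e, e), t) = e"
    proof (intro ballI)
      fix e and t :: real
      assume that: "e \<in> topspace E" "t \<in> {0..1}"
      have e: "(e, e) \<in> diagonal E"
        using that(1) by (auto simp: diagonal_def)
      then have "(e, e) \<in> V" "w (e, e) = 1"
        using V(2) u(2) by (auto simp: w_def)
      moreover have "d (e, e) = (e, e)"
        by (simp add: d_def)
      ultimately show "homotopy_join ?h1 (homotopy_join ?h2 ?h3) ((e, e), t) = e"
        using that h0(2)[of "(e, e)"] \<sigma>(2)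
        by (auto simp: homotopy_join_def c_def)
    qed
  qed
qed

section \<open>Covers of the fibre square\<close>

text \<open>One open set \<open>V 0\<close> contains a neighbourhood of the whole diagonal, so
  cutting the other sets back inside \<open>V 0\<close> loses no point of the union. Hence the
  number of sets is unchanged.\<close>

lemma normalized_cover:
  assumes p: "hurewicz_fibration E B p"
    and E: "metrizable_ANR E" "separable_space E" "topspace E \<noteq> {}"
    and B: "metrizable_ANR B" "separable_space B"
    and U: "covers_fibre_square E p k U" "\<And>i. i \<le> k \<Longrightarrow> section_over E p (U i) (s i)"
    and \<Delta>: "diagonal E \<subseteq> U 0"
  obtains V s' where "covers_fibre_square E p k V"
    "\<And>i. i \<le> k \<Longrightarrow> openin (fibre_square E p) (V i) \<and> diagonal E \<subseteq> V i \<and> section_over E p (V i) (s' i) \<and>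
       (\<forall>e\<in>topspace E. s' i (e, e) = const_path e)"
proof -
  let ?X = "fibre_square E p"
  have metE: "metrizable_space E"
    using E(1) by (simp add: metrizable_ANR_def)
  have UX: "U i \<subseteq> topspace ?X" if "i \<le> k" for i
    using U(1) that by (auto simp: covers_fibre_square_def)
  have "\<exists>V g. openin ?X V \<and> U i \<subseteq> V \<and> vertical_homotopy E p (subtopology ?X V) fst snd g" if i: "i \<le> k" for i
    using section_extends_to_open[OF p E(1,2) B UX[OF i]
        section_over_imp_vertical_homotopy[OF U(2)[OF i] UX[OF i]]] by metis
  then obtain V g where V: "\<And>i. i \<le> k \<Longrightarrow> openin ?X (V i) \<and> U i \<subseteq> V i \<and>
      vertical_homotopy E p (subtopology ?X (V i)) fst snd (g i)"
    by metis
  obtain N \<sigma> where N: "openin ?X N" "diagonal E \<subseteq> N"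
    and \<sigma>: "vertical_homotopy E p (subtopology ?X N) fst snd \<sigma>"
      "\<forall>e\<in>topspace E. \<forall>t\<in>{0..1}. \<sigma> ((e, e), t) = e"
    by (rule fibrewise_locally_equiconnected[OF p E B])
  have V0: "openin ?X (V 0)" "diagonal E \<subseteq> V 0" "vertical_homotopy E p (subtopology ?X (V 0)) fst snd (g 0)"
    using V[of 0] \<Delta> by auto
  obtain g0 where g0: "vertical_homotopy E p (subtopology ?X (V 0)) fst snd g0"
      "\<forall>e\<in>topspace E. \<forall>t\<in>{0..1}. g0 ((e, e), t) = e"
    by (rule section_normalize_on_diagonal[OF metE N \<sigma> V0])
  have "closedin ?X (diagonal E)" "closedin ?X (topspace ?X - V 0)" "disjnt (diagonal E) (topspace ?X - V 0)"
    using closedin_diagonal[OF metrizable_imp_Hausdorff_space[OF metE]] V0(1,2) by (auto simp: disjnt_def)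
  then obtain u where u: "continuous_map ?X (top_of_set {0..1::real}) u"
      "u ` diagonal E \<subseteq> {0}" "u ` (topspace ?X - V 0) \<subseteq> {1}"
    using Urysohn_lemma[OF metrizable_imp_normal_space[OF metrizable_fibre_square[OF metE]], of p "diagonal E" "topspace ?X - V 0" 0 1]
    by auto
  have cu: "continuous_map ?X euclideanreal u"
    using u(1) by (simp add: continuous_map_unit_interval)
  \<comment> \<open>Cutting at \<open>u > 1/2\<close> makes \<open>Q i\<close> disjoint from
    \<open>P\<close>. A point of \<open>V i\<close> lost in this way has \<open>u \<le> 1/2\<close>
    and therefore lies in \<open>V 0\<close>, as \<open>u = 1\<close> outside
    \<open>V 0\<close>.\<close>
  define P where "P = N \<inter> {x \<in> topspace ?X. u x \<in> {..<1/2}}"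
  define Q where "Q i = V i \<inter> {x \<in> topspace ?X. u x \<in> {1/2<..}}" for i
  have P: "openin ?X P" and Q: "openin ?X (Q i)" if "i \<le> k" for i
    unfolding P_def Q_def using N(1) V[OF that]
    by (intro openin_Int openin_continuous_map_preimage[OF cu]; simp)+
  have P_diag: "diagonal E \<subseteq> P"
    using N(2) u(2) diagonal_subset[of E p] by (force simp: P_def)
  define V' where "V' i = (if i = 0 then V 0 else P \<union> Q i)" for i
  define g' where "g' i = (if i = 0 then g0 else (\<lambda>(x, t). if x \<in> P then \<sigma> (x, t) else g i (x, t)))" for i
  have open': "openin ?X (V' i)" if "i \<le> k" for i
    using P[OF that] Q[OF that] V0(1) by (auto simp: V'_def openin_Un)
  have diag': "diagonal E \<subseteq> V' i" for i
    using P_diag V0(2) by (auto simp: V'_def)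
  have hom': "vertical_homotopy E p (subtopology ?X (V' i)) fst snd (g' i)" if i: "i \<le> k" for i
  proof -
    have "vertical_homotopy E p (subtopology ?X (P \<union> Q i)) fst snd
        (\<lambda>(x, t). if x \<in> P then \<sigma> (x, t) else g i (x, t))"
    proof (rule vertical_homotopy_Un[OF P[OF i] Q[OF i]])
      show "P \<inter> Q i = {}"
        by (auto simp: P_def Q_def)
      show "vertical_homotopy E p (subtopology ?X P) fst snd \<sigma>"
        using \<sigma>(1) by (rule vertical_homotopy_subset) (auto simp: P_def)
      show "vertical_homotopy E p (subtopology ?X (Q i)) fst snd (g i)"
        using V[OF i] by (auto simp: Q_def intro: vertical_homotopy_subset)
    qed
    then show ?thesis
      using g0(1) by (simp add: V'_def g'_def)
  qed
  have const': "g' i ((e, e), t) = e" if "e \<in> topspace E" "t \<in> {0..1}" for i e t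
  proof -
    have "(e, e) \<in> P"
      using P_diag that(1) by (auto simp: diagonal_def)
    then show ?thesis
      using that g0(2) \<sigma>(2) by (simp add: g'_def)
  qed
  show thesis
  proof (rule that[of V' "\<lambda>i x. restrict (\<lambda>t. g' i (x, t)) {0..1}"])
    show "covers_fibre_square E p k V'"
      unfolding covers_fibre_square_def
    proof (intro equalityI subsetI)
      show "x \<in> topspace ?X" if "x \<in> (\<Union>i\<le>k. V' i)" for x
        using that openin_subset[OF open'] by blast
      fix x assume x: "x \<in> topspace ?X"
      then obtain i where i: "i \<le> k" "x \<in> V i"
        using U(1) V unfolding covers_fibre_square_def by blast
      show "x \<in> (\<Union>i\<le>k. V' i)"
      proof (cases "x \<in> V 0")
        case True
        then show ?thesis by (auto simp: V'_def)
      next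
        case False
        then have "u x = 1"
          using u(3) x by auto
        then have "x \<in> V' i"
          using i False x by (cases "i = 0") (auto simp: V'_def Q_def)
        then show ?thesis
          using i(1) by blast
      qed
    qed
    show "openin ?X (V' i) \<and> diagonal E \<subseteq> V' i \<and>
        section_over E p (V' i) (\<lambda>x. restrict (\<lambda>t. g' i (x, t)) {0..1}) \<and>
        (\<forall>e\<in>topspace E. restrict (\<lambda>t. g' i ((e, e), t)) {0..1} = const_path e)" if i: "i \<le> k" for i
      using open'[OF i] diag' vertical_homotopy_imp_section_over[OF hom'[OF i] openin_subset[OF open'[OF i]]]
      by (auto simp: const_path_def const' intro!: restrict_ext)
  qed
qed

lemma open_cover_from_cover:
  assumes p: "hurewicz_fibration E B p"
    and E: "metrizable_ANR E" "separable_space E"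
    and B: "metrizable_ANR B" "separable_space B"
    and U: "covers_fibre_square E p k U" "\<And>i. i \<le> k \<Longrightarrow> \<exists>s. section_over E p (U i) s"
  obtains V where "covers_fibre_square E p k V"
    "\<And>i. i \<le> k \<Longrightarrow> openin (fibre_square E p) (V i) \<and> (\<exists>s. section_over E p (V i) s)"
proof -
  let ?X = "fibre_square E p"
  have UX: "U i \<subseteq> topspace ?X" if "i \<le> k" for i
    using U(1) that by (auto simp: covers_fibre_square_def)
  have "\<exists>V. openin ?X V \<and> U i \<subseteq> V \<and> (\<exists>s. section_over E p V s)" if i: "i \<le> k" for i
  proof -
    obtain s where s: "section_over E p (U i) s"
      using U(2)[OF i] by blast
    obtain V g where V: "openin ?X V" "U i \<subseteq> V" "vertical_homotopy E p (subtopology ?X V) fst snd g"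
      using section_extends_to_open[OF p E B UX[OF i] section_over_imp_vertical_homotopy[OF s UX[OF i]]]
      by metis
    then show ?thesis
      using vertical_homotopy_imp_section_over[OF V(3) openin_subset[OF V(1)]] by blast
  qed
  then obtain V where V: "\<And>i. i \<le> k \<Longrightarrow> openin ?X (V i) \<and> U i \<subseteq> V i \<and> (\<exists>s. section_over E p (V i) s)"
    by metis
  moreover have "(\<Union>i\<le>k. V i) = topspace ?X"
  proof
    show "(\<Union>i\<le>k. V i) \<subseteq> topspace ?X"
      using V openin_subset by fast
    show "topspace ?X \<subseteq> (\<Union>i\<le>k. V i)"
      using U(1) V unfolding covers_fibre_square_def by blast
  qed
  ultimately show thesis
    by (intro that[of V]) (auto simp: covers_fibre_square_def)
qed

section \<open>Comparison of the three invariants\<close>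

lemma least_enat_le: "P n \<Longrightarrow> least_enat P \<le> enat n"
  by (auto simp: least_enat_def intro: Least_le)

lemma least_enat_mono:
  assumes "\<And>n. P n \<Longrightarrow> Q n"
  shows "least_enat Q \<le> least_enat P"
proof (cases "\<exists>n. P n")
  case True
  then have "P (LEAST n. P n)" by (rule LeastI_ex)
  with assms have "Q (LEAST n. P n)" .
  then show ?thesis
    using True least_enat_le[of Q] by (simp add: least_enat_def)
qed (simp add: least_enat_def)

theorem corollary3p15:
  fixes E :: "'a topology" and B :: "'b topology" and p :: "'a \<Rightarrow> 'b"
  assumes "locally_trivial_fibration E B p"
    and "metrizable_space E" and "separable_space E" and "metrizable_ANR E"
    and "metrizable_space B" and "separable_space B" and "metrizable_ANR B"
  shows "TC E p = TC_gen E p \<and>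
    (\<forall>(k :: nat) (U :: nat \<Rightarrow> ('a \<times> 'a) set) (s :: nat \<Rightarrow> 'a \<times> 'a \<Rightarrow> real \<Rightarrow> 'a).
       covers_fibre_square E p k U \<and> (\<forall>i\<le>k. section_over E p (U i) (s i)) \<and> diagonal E \<subseteq> U 0 \<longrightarrow>
       TC_mon E p \<le> enat k \<and>
       (TC E p = enat k \<longrightarrow>
          TC_mon E p = TC E p \<and> TC E p = TC_gen E p \<and> TC_gen E p = enat k))"
proof -
  have p: "hurewicz_fibration E B p"
    using assms(1) by (simp add: locally_trivial_fibration_def)
  have TC_gen: "TC E p = TC_gen E p"
  proof (rule antisym)
    show "TC_gen E p \<le> TC E p"
      unfolding TC_def TC_gen_def by (rule least_enat_mono) blast
    show "TC E p \<le> TC_gen E p"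
      unfolding TC_def TC_gen_def
    proof (rule least_enat_mono, elim exE conjE)
      fix n U assume "covers_fibre_square E p n U" "\<forall>i\<le>n. \<exists>s. section_over E p (U i) s"
      then show "\<exists>V. covers_fibre_square E p n V \<and>
          (\<forall>i\<le>n. openin (fibre_square E p) (V i) \<and> (\<exists>s. section_over E p (V i) s))"
        using open_cover_from_cover[OF p assms(4,3,7,6)] by metis
    qed
  qed
  \<comment> \<open>A monoidal cover is in particular an open cover with sections. If
    \<open>TC E p = enat k\<close>, this inequality and the bound by \<open>k\<close> squeeze
    \<open>TC_mon E p\<close>.\<close>
  have "TC E p \<le> TC_mon E p"
    unfolding TC_def TC_mon_def by (rule least_enat_mono) blast
  moreover have "TC_mon E p \<le> enat k"
    if U: "covers_fibre_square E p k U" "\<forall>i\<le>k. section_over E p (U i) (s i)" "diagonal E \<subseteq> U 0" for k U s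
  proof (cases "topspace E = {}")
    \<comment> \<open>Distance coordinates need a point, so empty \<open>E\<close> is separate; all
      sets of the cover are then empty and \<open>U\<close> itself is a monoidal cover.\<close>
    case True
    then have "topspace (fibre_square E p) = {}" "diagonal E = {}"
      by (auto simp: topspace_fibre_square diagonal_def)
    then have "U i = {}" if "i \<le> k" for i
      using U(1) that by (auto simp: covers_fibre_square_def)
    then show ?thesis
      unfolding TC_mon_def using U True
      by (intro least_enat_le exI[of _ U]) (auto simp: diagonal_def)
  next
    case False
    obtain V s' where "covers_fibre_square E p k V"
      "\<And>i. i \<le> k \<Longrightarrow> openin (fibre_square E p) (V i) \<and> diagonal E \<subseteq> V i \<and> section_over E p (V i) (s' i) \<and>
         (\<forall>e\<in>topspace E. s' i (e, e) = const_path e)"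
      using normalized_cover[OF p assms(4,3) False assms(7,6) U(1) _ U(3)] U(2) by blast
    then show ?thesis
      unfolding TC_mon_def by (intro least_enat_le exI[of _ V]) blast
  qed
  ultimately show ?thesis
    using TC_gen by (auto intro: antisym)
qed

end
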